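(* Let $k$ be a positive integer. If $k$ is not equal to $3$, then $$ \varepsilon(3,k)=\frac{1}{\sqrt{2(2k^2-4k+5)(2k^2-2k+1)}}. $$
   Context: For positive integers $d$ and $k$, a lattice $(d,k)$-polytope is the convex hull of a finite non-empty subset of $\mathbb{Z}^d\cap[0,k]^d$. Distances are Euclidean: $d(P,Q)=\min\{\|p-q\|:p\in P,\ q\in Q\}$. The number $\varepsilon(d,k)$ is the smallest possible value of $d(P,Q)$ over all pairs of disjoint lattice $(d,k)$-polytopes $P$ and $Q$ (there are only finitely many such pairs). *)

theory Defs
  imports "HOL-Analysis.Analysis"
begin

definition lattice_box :: "nat \<Rightarrow> (real ^ 'n) set" where
  "lattice_box k = {x. \<forall>i. x $ i \<in> \<int> \<and> 0 \<le> x $ i \<and> x $ i \<le> real k}"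

definition lattice_polytope :: "nat \<Rightarrow> (real ^ 'n) set \<Rightarrow> bool" where
  "lattice_polytope k P \<longleftrightarrow>
     (\<exists>S. finite S \<and> S \<noteq> {} \<and> S \<subseteq> lattice_box k \<and> P = convex hull S)"

definition polytope_distances :: "'n::finite itself \<Rightarrow> nat \<Rightarrow> real set" where
  "polytope_distances _ k =
     {setdist P Q | P Q :: (real ^ 'n) set.
        lattice_polytope k P \<and> lattice_polytope k Q \<and> P \<inter> Q = {}}"

text \<open>The dimension \<open>d\<close> is the cardinality of the index type: \<open>epsilon TYPE('n) k\<close> is the
  paper's \<open>\<epsilon>(CARD('n), k)\<close>. The minimum is over a finite set, nonempty for \<open>k > 0\<close>
  (shown below); \<open>setdist\<close> is an infimum in general, attained here because polytopes are compact.\<close>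

definition epsilon :: "'n::finite itself \<Rightarrow> nat \<Rightarrow> real" where
  "epsilon T k = Min (polytope_distances T k)"

lemma finite_lattice_box: "finite (lattice_box k :: (real ^ 'n) set)"
proof -
  let ?A = "{x :: real. x \<in> \<int> \<and> 0 \<le> x \<and> x \<le> real k}"
  have "?A \<subseteq> real_of_int ` {0..int k}"
    by (auto elim!: Ints_cases)
  then have "finite ?A"
    by (rule finite_subset) simp
  then have "finite {f :: 'n \<Rightarrow> real. range f \<subseteq> ?A}"
    using finite_set_of_finite_funs[of "UNIV :: 'n set" ?A 0] by (simp add: image_subset_iff)
  then have "finite (vec_lambda ` {f :: 'n \<Rightarrow> real. range f \<subseteq> ?A})"
    by simp
  moreover have "lattice_box k \<subseteq> vec_lambda ` {f :: 'n \<Rightarrow> real. range f \<subseteq> ?A}"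
  proof
    fix x :: "real ^ 'n" assume "x \<in> lattice_box k"
    then have "($) x \<in> {f. range f \<subseteq> ?A}" by (auto simp: lattice_box_def)
    then show "x \<in> vec_lambda ` {f. range f \<subseteq> ?A}"
      by (metis (no_types, lifting) image_eqI vec_nth_inverse)
  qed
  ultimately show ?thesis using finite_subset by blast
qed

lemma finite_lattice_polytopes: "finite {P :: (real ^ 'n) set. lattice_polytope k P}"
proof -
  have "{P :: (real ^ 'n) set. lattice_polytope k P} \<subseteq> (hull) convex ` Pow (lattice_box k)"
    by (auto simp: lattice_polytope_def)
  then show ?thesis
    using finite_lattice_box finite_subset by blast
qed

lemma finite_polytope_distances: "finite (polytope_distances T k)"
proof -
  let ?L = "{P :: (real ^ 'a) set. lattice_polytope k P}"
  have "polytope_distances T k \<subseteq> (\<lambda>(P, Q). setdist P Q) ` (?L \<times> ?L)"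
    by (auto simp: polytope_distances_def)
  then show ?thesis
    using finite_lattice_polytopes finite_subset by blast
qed

lemma polytope_distances_nonempty:
  assumes "k > 0"
  shows "polytope_distances (T :: 'n::finite itself) k \<noteq> {}"
proof -
  have "lattice_polytope k {0 :: real ^ 'n}" "lattice_polytope k {1 :: real ^ 'n}"
    using assms unfolding lattice_polytope_def
    by (intro exI[of _ "{0}"] exI[of _ "{1}"]; simp add: lattice_box_def)+
  moreover have "{0 :: real ^ 'n} \<inter> {1} = {}"
    by (simp add: vec_eq_iff)
  ultimately show ?thesis
    unfolding polytope_distances_def by blast
qed

lemma setdist_lattice_polytopes_attained:
  assumes "lattice_polytope k P" "lattice_polytope k Q"
  obtains p q where "p \<in> P" "q \<in> Q" "setdist P Q = norm (p - q)"
    "\<And>p' q'. p' \<in> P \<Longrightarrow> q' \<in> Q \<Longrightarrow> norm (p - q) \<le> norm (p' - q')"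
proof -
  have "compact P" "P \<noteq> {}" "compact Q" "Q \<noteq> {}"
    using assms by (auto simp: lattice_polytope_def finite_imp_compact_convex_hull)
  then obtain p q where pq: "p \<in> P" "q \<in> Q" "dist p q = setdist P Q"
    using setdist_compact_closed compact_imp_closed by metis
  show thesis
  proof (rule that)
    show "setdist P Q = norm (p - q)" using pq by (simp add: dist_norm)
    show "norm (p - q) \<le> norm (p' - q')" if "p' \<in> P" "q' \<in> Q" for p' q'
      using pq setdist_le_dist[OF that] by (simp add: dist_norm)
  qed (use pq in auto)
qed

end

theory Submission
  imports Defs
begin

text \<open>At a closest pair \<open>p\<close>, \<open>q\<close> the vector \<open>p - q\<close> is orthogonal to the faces of the two polytopes
  that contain \<open>p\<close> and \<open>q\<close>. If lattice directions \<open>u\<close>, \<open>v\<close> of these faces are independent, the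
  distance is \<open>\<bar>D\<bar> / \<parallel>u \<times> v\<parallel>\<close>, where \<open>D \<noteq> 0\<close> is the integer \<open>det (c, u, v)\<close> with \<open>c\<close> joining a vertex
  of one face to a vertex of the other; parallel faces and triangles are far from the bound.
  The essential case is that of two segments, where \<open>\<parallel>u \<times> v\<parallel>\<^sup>2 \<le> M D\<^sup>2\<close> must be shown for the
  claimed inverse square distance \<open>M\<close>. Since \<open>\<parallel>u \<times> v\<parallel>\<^sup>2 \<le> 8 k\<^sup>4 \<le> 4 M\<close>, only \<open>\<bar>D\<bar> = 1\<close> matters.
  Up to symmetry \<open>u\<close> and \<open>v\<close> deviate from the diagonals \<open>(k, k, k)\<close> and \<open>(k, k, -k)\<close> by nonnegative
  deficits. As \<open>k\<close> does not divide \<open>D\<close>, some deficits are positive; as \<open>\<parallel>u \<times> v\<parallel>\<^sup>2\<close> is convex in each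
  coordinate, checking the vertices of a few boxes bounds it by \<open>M\<close> unless the deficits form one of eight
  explicit patterns, and in these \<open>D\<close> is computed and differs from \<open>1\<close> and \<open>-1\<close> (for \<open>k \<ge> 4\<close>).\<close>

section \<open>Integer vectors with a large cross product\<close>

text \<open>The squared norm of the cross product. The ring is arbitrary because the formula is
  needed over \<open>int\<close>, \<open>real\<close> and \<open>int poly\<close>; in the last case
  it describes box vertices that depend on \<open>k\<close>. The same applies to
  \<open>kiss_bound\<close>.\<close>

definition cross_sq :: "'a::comm_ring_1 \<Rightarrow> 'a \<Rightarrow> 'a \<Rightarrow> 'a \<Rightarrow> 'a \<Rightarrow> 'a \<Rightarrow> 'a" where
  "cross_sq u1 u2 u3 v1 v2 v3 =
    (u2 * v3 - u3 * v2)\<^sup>2 + (u3 * v1 - u1 * v3)\<^sup>2 + (u1 * v2 - u2 * v1)\<^sup>2"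

definition kiss_bound :: "'a::comm_ring_1 \<Rightarrow> 'a" where
  "kiss_bound k = 2 * (2 * k\<^sup>2 - 4 * k + 5) * (2 * k\<^sup>2 - 2 * k + 1)"

section \<open>Convexity in each coordinate and reduction to the vertices of a box\<close>

lemma convex_quadratic_le:
  fixes A B C m lo hi x :: int
  assumes "0 \<le> A" "lo \<le> x" "x \<le> hi"
    and "A * lo\<^sup>2 + B * lo + C \<le> m" "A * hi\<^sup>2 + B * hi + C \<le> m"
  shows "A * x\<^sup>2 + B * x + C \<le> m"
proof (cases "lo = hi")
  case True
  then show ?thesis using assms by auto
next
  case False
  \<comment> \<open>The value at \<open>x\<close> is compared with the weighted mean of the two end
    values; everything is multiplied by \<open>hi - lo\<close>, so that no division of integers
    occurs.\<close>
  have "(hi - x) * (A * lo\<^sup>2 + B * lo + C) \<le> (hi - x) * m"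
       "(x - lo) * (A * hi\<^sup>2 + B * hi + C) \<le> (x - lo) * m"
    using assms by (auto intro: mult_left_mono)
  moreover have "0 \<le> A * ((x - lo) * (hi - x)) * (hi - lo)"
    using assms by (intro mult_nonneg_nonneg) auto
  moreover have "(hi - lo) * (A * x\<^sup>2 + B * x + C) =
      (hi - x) * (A * lo\<^sup>2 + B * lo + C) + (x - lo) * (A * hi\<^sup>2 + B * hi + C)
      - A * ((x - lo) * (hi - x)) * (hi - lo)"
    by algebra
  ultimately have "(hi - lo) * (A * x\<^sup>2 + B * x + C) \<le> (hi - x) * m + (x - lo) * m"
    by linarith
  then have "(hi - lo) * (A * x\<^sup>2 + B * x + C) \<le> (hi - lo) * m"
    by (simp add: algebra_simps)
  then show ?thesis
    using False assms(2,3) by (metis (no_types) diff_gt_0_iff_gt less_le_trans linorder_not_less mult_le_cancel_left_pos order_le_less)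
qed

text \<open>As a function of \<open>u1\<close>, \<open>cross_sq\<close> is a quadratic with leading
  coefficient \<open>v2^2 + v3^2\<close>, which is nonnegative.\<close>

lemma cross_sq_le_endpoint1:
  fixes u1 :: int
  assumes "lo \<le> u1" "u1 \<le> hi"
    and "cross_sq lo u2 u3 v1 v2 v3 \<le> m" "cross_sq hi u2 u3 v1 v2 v3 \<le> m"
  shows "cross_sq u1 u2 u3 v1 v2 v3 \<le> m"
proof -
  have *: "cross_sq x u2 u3 v1 v2 v3 = (v3\<^sup>2 + v2\<^sup>2) * x\<^sup>2
      + (- 2 * u3 * v1 * v3 - 2 * u2 * v1 * v2) * x
      + ((u2 * v3 - u3 * v2)\<^sup>2 + (u3 * v1)\<^sup>2 + (u2 * v1)\<^sup>2)" for x
    unfolding cross_sq_def by algebra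
  show ?thesis
    unfolding * by (rule convex_quadratic_le[OF _ assms(1,2) assms(3,4)[unfolded *]]) simp
qed

lemma cross_sq_swap12: "cross_sq u2 u1 u3 v2 v1 v3 = cross_sq u1 u2 u3 v1 v2 v3"
  by (simp add: cross_sq_def algebra_simps power2_eq_square)

lemma cross_sq_swap13: "cross_sq u3 u2 u1 v3 v2 v1 = cross_sq u1 u2 u3 v1 v2 v3"
  by (simp add: cross_sq_def algebra_simps power2_eq_square)

lemma cross_sq_commute: "cross_sq v1 v2 v3 u1 u2 u3 = cross_sq u1 u2 u3 v1 v2 v3"
  by (simp add: cross_sq_def algebra_simps power2_eq_square)

text \<open>The six coordinates are moved to endpoints one after another. Permuting the coordinates
  and commuting the two vectors carry the case of \<open>u1\<close> over to the other five.\<close>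

lemma cross_sq_le_vertices:
  fixes u1 :: int
  assumes vertex: "\<And>x1 x2 x3 y1 y2 y3. x1 \<in> {a1,b1} \<Longrightarrow> x2 \<in> {a2,b2} \<Longrightarrow> x3 \<in> {a3,b3} \<Longrightarrow>
      y1 \<in> {c1,d1} \<Longrightarrow> y2 \<in> {c2,d2} \<Longrightarrow> y3 \<in> {c3,d3} \<Longrightarrow> cross_sq x1 x2 x3 y1 y2 y3 \<le> m"
    and "u1 \<in> {a1..b1}" "u2 \<in> {a2..b2}" "u3 \<in> {a3..b3}" "v1 \<in> {c1..d1}" "v2 \<in> {c2..d2}" "v3 \<in> {c3..d3}"
  shows "cross_sq u1 u2 u3 v1 v2 v3 \<le> m"
proof -
  have e2: "cross_sq u1 u2 u3 v1 v2 v3 \<le> m"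
    if "lo \<le> u2" "u2 \<le> hi" "cross_sq u1 lo u3 v1 v2 v3 \<le> m" "cross_sq u1 hi u3 v1 v2 v3 \<le> m"
    for lo hi u1 u2 u3 v1 v2 v3 :: int
    using cross_sq_le_endpoint1[of lo u2 hi u1 u3 v2 v1 v3 m] that by (simp add: cross_sq_swap12)
  have e3: "cross_sq u1 u2 u3 v1 v2 v3 \<le> m"
    if "lo \<le> u3" "u3 \<le> hi" "cross_sq u1 u2 lo v1 v2 v3 \<le> m" "cross_sq u1 u2 hi v1 v2 v3 \<le> m"
    for lo hi u1 u2 u3 v1 v2 v3 :: int
    using cross_sq_le_endpoint1[of lo u3 hi u2 u1 v3 v2 v1 m] that by (simp add: cross_sq_swap13)
  have e4: "cross_sq u1 u2 u3 v1 v2 v3 \<le> m"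
    if "lo \<le> v1" "v1 \<le> hi" "cross_sq u1 u2 u3 lo v2 v3 \<le> m" "cross_sq u1 u2 u3 hi v2 v3 \<le> m"
    for lo hi u1 u2 u3 v1 v2 v3 :: int
    using cross_sq_le_endpoint1[of lo v1 hi v2 v3 u1 u2 u3 m] that by (simp add: cross_sq_commute)
  have e5: "cross_sq u1 u2 u3 v1 v2 v3 \<le> m"
    if "lo \<le> v2" "v2 \<le> hi" "cross_sq u1 u2 u3 v1 lo v3 \<le> m" "cross_sq u1 u2 u3 v1 hi v3 \<le> m"
    for lo hi u1 u2 u3 v1 v2 v3 :: int
    using e2[of lo v2 hi v1 v3 u1 u2 u3] that by (simp add: cross_sq_commute)
  have e6: "cross_sq u1 u2 u3 v1 v2 v3 \<le> m"
    if "lo \<le> v3" "v3 \<le> hi" "cross_sq u1 u2 u3 v1 v2 lo \<le> m" "cross_sq u1 u2 u3 v1 v2 hi \<le> m"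
    for lo hi u1 u2 u3 v1 v2 v3 :: int
    using e3[of lo v3 hi v1 v2 u1 u2 u3] that by (simp add: cross_sq_commute)
  have v6: "cross_sq x1 x2 x3 y1 y2 v3 \<le> m"
    if "x1 \<in> {a1,b1}" "x2 \<in> {a2,b2}" "x3 \<in> {a3,b3}" "y1 \<in> {c1,d1}" "y2 \<in> {c2,d2}" for x1 x2 x3 y1 y2
    by (rule e6[of c3 _ d3]) (use assms(2-) vertex that in simp_all)
  have v5: "cross_sq x1 x2 x3 y1 v2 v3 \<le> m"
    if "x1 \<in> {a1,b1}" "x2 \<in> {a2,b2}" "x3 \<in> {a3,b3}" "y1 \<in> {c1,d1}" for x1 x2 x3 y1
    by (rule e5[of c2 _ d2]) (use assms(2-) v6 that in simp_all)
  have v4: "cross_sq x1 x2 x3 v1 v2 v3 \<le> m"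
    if "x1 \<in> {a1,b1}" "x2 \<in> {a2,b2}" "x3 \<in> {a3,b3}" for x1 x2 x3
    by (rule e4[of c1 _ d1]) (use assms(2-) v5 that in simp_all)
  have v3: "cross_sq x1 x2 u3 v1 v2 v3 \<le> m"
    if "x1 \<in> {a1,b1}" "x2 \<in> {a2,b2}" for x1 x2
    by (rule e3[of a3 _ b3]) (use assms(2-) v4 that in simp_all)
  have v2: "cross_sq x1 u2 u3 v1 v2 v3 \<le> m"
    if "x1 \<in> {a1,b1}" for x1
    by (rule e2[of a2 _ b2]) (use assms(2-) v3 that in simp_all)
  show ?thesis
    by (rule cross_sq_le_endpoint1[of a1 _ b1]) (use assms(2-) v2 in simp_all)
qed

section \<open>Testing box vertices for all large \<open>k\<close> at once by polynomial
  coefficients\<close>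

lemma poly_cross_sq:
  "poly (cross_sq p1 p2 p3 q1 q2 q3) x =
   cross_sq (poly p1 x) (poly p2 x) (poly p3 x) (poly q1 x) (poly q2 x) (poly q3 x)"
  by (simp add: cross_sq_def)

lemma poly_kiss_bound: "poly (kiss_bound p) x = kiss_bound (poly p x)"
  by (simp add: kiss_bound_def)

lemma poly_nonneg:
  fixes p :: "int poly"
  assumes "\<forall>c\<in>set (coeffs p). 0 \<le> c" "0 \<le> x"
  shows "0 \<le> poly p x"
proof -
  have "0 \<le> coeff p i" for i
    using assms(1) by (cases "i \<le> degree p") (auto simp: coeffs_def coeff_eq_0 split: if_splits)
  then show ?thesis
    unfolding poly_altdef using assms(2) by (intro sum_nonneg) simp
qed

text \<open>If the bounds of the box are polynomials in \<open>j\<close>, nonnegative coefficients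
  at each of the 64 vertices are enough for every \<open>j \<ge> 0\<close>, so one finite
  computation covers infinitely many boxes.\<close>

lemma cross_sq_le_poly_vertices:
  fixes j :: int
  assumes vertex: "\<forall>x1\<in>set [a1,b1]. \<forall>x2\<in>set [a2,b2]. \<forall>x3\<in>set [a3,b3].
      \<forall>y1\<in>set [c1,d1]. \<forall>y2\<in>set [c2,d2]. \<forall>y3\<in>set [c3,d3].
      \<forall>c\<in>set (coeffs (m - cross_sq x1 x2 x3 y1 y2 y3)). 0 \<le> c"
    and "0 \<le> j"
    and "u1 \<in> {poly a1 j..poly b1 j}" "u2 \<in> {poly a2 j..poly b2 j}" "u3 \<in> {poly a3 j..poly b3 j}"
    and "v1 \<in> {poly c1 j..poly d1 j}" "v2 \<in> {poly c2 j..poly d2 j}" "v3 \<in> {poly c3 j..poly d3 j}"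
  shows "cross_sq u1 u2 u3 v1 v2 v3 \<le> poly m j"
proof (rule cross_sq_le_vertices[OF _ assms(3-8)])
  have le: "cross_sq (poly p1 j) (poly p2 j) (poly p3 j) (poly q1 j) (poly q2 j) (poly q3 j) \<le> poly m j"
    if "p1 \<in> {a1,b1}" "p2 \<in> {a2,b2}" "p3 \<in> {a3,b3}" "q1 \<in> {c1,d1}" "q2 \<in> {c2,d2}" "q3 \<in> {c3,d3}"
    for p1 p2 p3 q1 q2 q3
  proof -
    have "\<forall>c\<in>set (coeffs (m - cross_sq p1 p2 p3 q1 q2 q3)). 0 \<le> c"
      using vertex that by (metis (no_types) list.simps(15) empty_set)
    then have "0 \<le> poly (m - cross_sq p1 p2 p3 q1 q2 q3) j"
      using assms(2) by (rule poly_nonneg)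
    then show ?thesis
      by (simp add: poly_cross_sq)
  qed
  fix x1 x2 x3 y1 y2 y3
  assume "x1 \<in> {poly a1 j, poly b1 j}" "x2 \<in> {poly a2 j, poly b2 j}" "x3 \<in> {poly a3 j, poly b3 j}"
    "y1 \<in> {poly c1 j, poly d1 j}" "y2 \<in> {poly c2 j, poly d2 j}" "y3 \<in> {poly c3 j, poly d3 j}"
  then obtain p1 p2 p3 q1 q2 q3 where
    "p1 \<in> {a1,b1}" "x1 = poly p1 j" "p2 \<in> {a2,b2}" "x2 = poly p2 j" "p3 \<in> {a3,b3}" "x3 = poly p3 j"
    "q1 \<in> {c1,d1}" "y1 = poly q1 j" "q2 \<in> {c2,d2}" "y2 = poly q2 j" "q3 \<in> {c3,d3}" "y3 = poly q3 j"
    by (metis (no_types) insertCI insertE singletonD)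
  then show "cross_sq x1 x2 x3 y1 y2 y3 \<le> poly m j"
    using le by simp
qed

text \<open>The arguments are lower bounds for the deficits. With \<open>k = l + j\<close>, the polynomials in \<open>j\<close>
  tested here are the values of \<open>kiss_bound k - cross_sq\<close> at the vertices of the resulting box.\<close>

definition deficit_check :: "int \<Rightarrow> int \<Rightarrow> int \<Rightarrow> int \<Rightarrow> int \<Rightarrow> int \<Rightarrow> int \<Rightarrow> bool" where
  "deficit_check l q1 q2 q3 t1 t2 t3 \<longleftrightarrow>
    (\<forall>x1\<in>set [0,[:l-q1,1:]]. \<forall>x2\<in>set [0,[:l-q2,1:]]. \<forall>x3\<in>set [0,[:l-q3,1:]].
     \<forall>y1\<in>set [0,[:l-t1,1:]]. \<forall>y2\<in>set [0,[:l-t2,1:]]. \<forall>y3\<in>set [[:t3-l,-1:],0].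
     \<forall>c\<in>set (coeffs (kiss_bound [:l,1:] - cross_sq x1 x2 x3 y1 y2 y3)). 0 \<le> c)"

lemma cross_sq_le_if_deficits:
  assumes "deficit_check l q1 q2 q3 t1 t2 t3" "l \<le> k"
    and "u1 \<in> {0..k-q1}" "u2 \<in> {0..k-q2}" "u3 \<in> {0..k-q3}"
    and "v1 \<in> {0..k-t1}" "v2 \<in> {0..k-t2}" "v3 \<in> {t3-k..0}"
  shows "cross_sq u1 u2 u3 v1 v2 v3 \<le> kiss_bound k"
  using cross_sq_le_poly_vertices[OF assms(1)[unfolded deficit_check_def],
      of "k - l" u1 u2 u3 v1 v2 v3] assms(2-)
  by (simp add: poly_kiss_bound)

text \<open>For large \<open>k\<close>, \<open>cross_sq\<close> is \<open>8 k\<^sup>4 - 4 w k\<^sup>3 + \<dots>\<close>, where \<open>w\<close> is the sum of the deficits with the third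
  coordinates counted twice, while \<open>kiss_bound k = 8 k\<^sup>4 - 24 k\<^sup>3 + \<dots>\<close>. All boxes below have \<open>w \<ge> 6\<close>.\<close>

lemma deficit_check_boxes:
  "deficit_check 2 1 1 1 0 0 1"
  "deficit_check 2 1 0 1 0 1 1"
  "deficit_check 2 0 1 1 1 0 1"
  "deficit_check 2 0 0 1 1 1 1"
  "deficit_check 2 0 0 2 1 1 0"
  "deficit_check 2 1 0 2 0 1 0"
  "deficit_check 2 0 1 2 1 0 0"
  "deficit_check 2 2 1 1 1 0 0"
  "deficit_check 2 1 2 1 1 0 0"
  "deficit_check 2 1 1 1 2 0 0"
  "deficit_check 3 0 3 1 1 0 0"
  "deficit_check 3 0 2 1 3 0 0"
  "deficit_check 2 0 0 1 2 2 0"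
  "deficit_check 3 0 0 1 3 1 0"
  "deficit_check 2 1 1 1 1 1 0"
  "deficit_check 2 2 0 1 1 1 0"
  "deficit_check 2 0 2 1 1 1 0"
  "deficit_check 2 1 0 1 2 1 0"
  "deficit_check 2 0 1 1 2 1 0"
  by code_simp+

section \<open>Determinants and the exceptional deficit patterns\<close>

definition det3 :: "'a::comm_ring_1 \<Rightarrow> 'a \<Rightarrow> 'a \<Rightarrow> 'a \<Rightarrow> 'a \<Rightarrow> 'a \<Rightarrow> 'a \<Rightarrow> 'a \<Rightarrow> 'a \<Rightarrow> 'a" where
  "det3 c1 c2 c3 u1 u2 u3 v1 v2 v3 =
    c1 * (u2 * v3 - u3 * v2) + c2 * (u3 * v1 - u1 * v3) + c3 * (u1 * v2 - u2 * v1)"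

lemma abs_det3_eq_1_dvd:
  fixes d :: int
  assumes "\<bar>det3 c1 c2 c3 u1 u2 u3 v1 v2 v3\<bar> = 1" "d dvd det3 c1 c2 c3 u1 u2 u3 v1 v2 v3" "0 \<le> d"
  shows "d = 1"
  using assms zdvd1_eq[of d] by (simp flip: dvd_abs_iff[of d "det3 c1 c2 c3 u1 u2 u3 v1 v2 v3"])

text \<open>In the names of the following lemmas, the digits are the deficits of \<open>u1\<close>, \<open>u2\<close> and of \<open>v1\<close>, \<open>v2\<close>.\<close>

lemma deficit_case_00_11:
  fixes k :: int
  assumes "2 \<le> k" "\<bar>det3 c1 c2 k k k (k - 1) (k - 1) (k - 1) (- k)\<bar> = 1"
  shows False
proof -
  \<comment> \<open>The cross product of the two directions has opposite first components and third
    component 0, so the determinant is a multiple of a number that is at least 5.\<close>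
  have "det3 c1 c2 k k k (k - 1) (k - 1) (k - 1) (- k) = (2 * (k * (k - 1)) + 1) * (c2 - c1)"
    unfolding det3_def by algebra
  moreover have pos: "2 \<le> k * (k - 1)"
    using mult_mono[of 2 k 1 "k - 1"] assms(1) by simp
  ultimately have "2 * (k * (k - 1)) + 1 = 1"
    by (intro abs_det3_eq_1_dvd[OF assms(2)]) simp_all
  then show False using pos by auto
qed

text \<open>In the enumerations below, the determinant at fixed \<open>c1\<close>, \<open>c2\<close>
  is a polynomial of degree at most 2 in \<open>k\<close>. After the shift by 4, the facts
  \<open>0 \<le> j\<close> and \<open>0 \<le> j * j\<close> allow linear arithmetic to see that it
  is neither 1 nor -1.\<close>

lemma int_ge2_cases:
  assumes "2 \<le> (k::int)" "k \<noteq> 3"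
  obtains "k = 2" | j where "k = j + 4" "0 \<le> j" "0 \<le> j * j"
proof (cases "k = 2")
  case False
  then show ?thesis using that(2)[of "k - 4"] assms by simp
qed

text \<open>The determinant is \<open>k^2 - c1 * (2*k^2 - 2*k + 1) + c2 * (2*k^2 - 3*k + 2)\<close>.
  For \<open>k \<ge> 4\<close> none of the six admissible pairs gives 1 or -1. For
  \<open>k = 2\<close> the value -1 occurs, but there \<open>cross_sq\<close> is 45 and the bound is
  50. The next four patterns follow the same scheme.\<close>

lemma deficit_case_00_21:
  fixes k :: int
  assumes k: "2 \<le> k" "k \<noteq> 3" and c: "c1 \<in> {0..2}" "c2 \<in> {0..1}"
    and D: "\<bar>det3 c1 c2 k k k (k - 1) (k - 2) (k - 1) (- k)\<bar> = 1"
  shows "cross_sq k k (k - 1) (k - 2) (k - 1) (- k) \<le> kiss_bound k"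
  using k
proof (cases rule: int_ge2_cases)
  case 1
  then show ?thesis by (simp add: cross_sq_def kiss_bound_def)
next
  case (2 j)
  have "c1 = 0 \<or> c1 = 1 \<or> c1 = 2" "c2 = 0 \<or> c2 = 1" using c by auto
  then show ?thesis
    using D 2(2-) unfolding 2(1) by (elim disjE) (simp_all add: det3_def algebra_simps)
qed

lemma deficit_case_10_11:
  fixes k :: int
  assumes k: "2 \<le> k" "k \<noteq> 3" and c: "c1 \<in> {-1..1}" "c2 \<in> {0..1}"
    and D: "\<bar>det3 c1 c2 k (k - 1) k (k - 1) (k - 1) (k - 1) (- k)\<bar> = 1"
  shows "cross_sq (k - 1) k (k - 1) (k - 1) (k - 1) (- k) \<le> kiss_bound k"
  using k
proof (cases rule: int_ge2_cases)
  case 1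
  then show ?thesis by (simp add: cross_sq_def kiss_bound_def)
next
  case (2 j)
  have "c1 = -1 \<or> c1 = 0 \<or> c1 = 1" "c2 = 0 \<or> c2 = 1" using c by auto
  then show ?thesis
    using D 2(2-) unfolding 2(1) by (elim disjE) (simp_all add: det3_def algebra_simps)
qed

lemma deficit_case_01_11:
  fixes k :: int
  assumes k: "2 \<le> k" "k \<noteq> 3" and c: "c1 \<in> {0..1}" "c2 \<in> {-1..1}"
    and D: "\<bar>det3 c1 c2 k k (k - 1) (k - 1) (k - 1) (k - 1) (- k)\<bar> = 1"
  shows "cross_sq k (k - 1) (k - 1) (k - 1) (k - 1) (- k) \<le> kiss_bound k"
  using k
proof (cases rule: int_ge2_cases)
  case 1
  then show ?thesis by (simp add: cross_sq_def kiss_bound_def)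
next
  case (2 j)
  have "c1 = 0 \<or> c1 = 1" "c2 = -1 \<or> c2 = 0 \<or> c2 = 1" using c by auto
  then show ?thesis
    using D 2(2-) unfolding 2(1) by (elim disjE) (simp_all add: det3_def algebra_simps)
qed

text \<open>This is the pattern that fails for \<open>k = 3\<close>: the determinant is \<open>-1\<close> at \<open>c1 = 1\<close>, \<open>c2 = -1\<close>,
  and \<open>cross_sq\<close> is \<open>299 > 286\<close>.\<close>

lemma deficit_case_02_10:
  fixes k :: int
  assumes k: "2 \<le> k" "k \<noteq> 3" and c: "c1 \<in> {0..1}" "c2 \<in> {-2..0}"
    and D: "\<bar>det3 c1 c2 k k (k - 2) (k - 1) (k - 1) k (- k)\<bar> = 1"
  shows "cross_sq k (k - 2) (k - 1) (k - 1) k (- k) \<le> kiss_bound k"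
  using k
proof (cases rule: int_ge2_cases)
  case 1
  then show ?thesis by (simp add: cross_sq_def kiss_bound_def)
next
  case (2 j)
  have "c1 = 0 \<or> c1 = 1" "c2 = -2 \<or> c2 = -1 \<or> c2 = 0" using c by auto
  then show ?thesis
    using D 2(2-) unfolding 2(1) by (elim disjE) (simp_all add: det3_def algebra_simps)
qed

lemma deficit_case_02_20:
  fixes k :: int
  assumes k: "2 \<le> k" "k \<noteq> 3" and c: "c1 \<in> {0..2}" "c2 \<in> {-2..0}"
    and D: "\<bar>det3 c1 c2 k k (k - 2) (k - 1) (k - 2) k (- k)\<bar> = 1"
  shows "cross_sq k (k - 2) (k - 1) (k - 2) k (- k) \<le> kiss_bound k"
  using k
proof (cases rule: int_ge2_cases)
  case 1
  then show ?thesis by (simp add: cross_sq_def kiss_bound_def)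
next
  case (2 j)
  have "c1 = 0 \<or> c1 = 1 \<or> c1 = 2" "c2 = -2 \<or> c2 = -1 \<or> c2 = 0" using c by auto
  then show ?thesis
    using D 2(2-) unfolding 2(1) by (elim disjE) (simp_all add: det3_def algebra_simps)
qed

text \<open>The first direction is \<open>k - 1\<close> times \<open>(1, 1, 1)\<close>, so
  \<open>k - 1\<close> divides the determinant and only \<open>k = 2\<close> remains.\<close>

lemma deficit_case_11_10:
  fixes k :: int
  assumes k: "2 \<le> k" and D: "\<bar>det3 c1 c2 k (k - 1) (k - 1) (k - 1) (k - 1) k (- k)\<bar> = 1"
  shows "cross_sq (k - 1) (k - 1) (k - 1) (k - 1) k (- k) \<le> kiss_bound k"
proof -
  have "det3 c1 c2 k (k - 1) (k - 1) (k - 1) (k - 1) k (- k) =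
      (k - 1) * (c2 * (2 * k - 1) - 2 * c1 * k + k)"
    unfolding det3_def by algebra
  then have "k - 1 dvd det3 c1 c2 k (k - 1) (k - 1) (k - 1) (k - 1) k (- k)"
    by simp
  then have "k = 2" using abs_det3_eq_1_dvd[OF D] k by force
  then show ?thesis by (simp add: cross_sq_def kiss_bound_def)
qed

text \<open>The deficit \<open>t\<close> is free here, so congruences replace enumeration. For
  \<open>c2 = 0\<close> the vectors \<open>c\<close> and \<open>v\<close> are
  \<open>(c1, 0, 0)\<close> and \<open>(-t, 0, 0)\<close> modulo \<open>k\<close>. For
  \<open>c2 = -1\<close> the vectors \<open>u\<close>, \<open>c\<close>, \<open>v\<close> are
  \<open>(1, 0, 0)\<close>, \<open>(c1, -1, 1)\<close>, \<open>(1 - t, 1, -1)\<close> modulo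
  \<open>k - 1\<close>. Both times the determinant vanishes.\<close>

lemma deficit_case_01_t0:
  fixes k :: int
  assumes k: "2 \<le> k" and t: "1 \<le> t" "t \<le> k" and c2: "c2 \<in> {-1..0}"
    and D: "\<bar>det3 c1 c2 k k (k - 1) (k - 1) (k - t) k (- k)\<bar> = 1"
  shows "cross_sq k (k - 1) (k - 1) (k - t) k (- k) \<le> kiss_bound k"
proof (cases "c2 = 0")
  case True
  have "det3 c1 c2 k k (k - 1) (k - 1) (k - t) k (- k) =
      k * (k * k - (k - 1) * (k - t) - 2 * c1 * (k - 1))"
    unfolding det3_def True by algebra
  then have "k dvd det3 c1 c2 k k (k - 1) (k - 1) (k - t) k (- k)"
    by simp
  then show ?thesis using abs_det3_eq_1_dvd[OF D] k by force
next
  case False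
  then have c2: "c2 = - 1" using c2 by auto
  have "det3 c1 c2 k k (k - 1) (k - 1) (k - t) k (- k) =
      (k - 1) * (k\<^sup>2 - (k + 1) * (k - t) - 2 * c1 * k)"
    unfolding det3_def c2 by algebra
  then have "k - 1 dvd det3 c1 c2 k k (k - 1) (k - 1) (k - t) k (- k)"
    by simp
  then have "k = 2" using abs_det3_eq_1_dvd[OF D] k by force
  moreover from this t have "t = 1 \<or> t = 2" by auto
  ultimately show ?thesis by (auto simp: cross_sq_def kiss_bound_def)
qed

section \<open>Symmetries of the configuration and the combination of the cases\<close>

lemma det3_swap12: "det3 c2 c1 c3 u2 u1 u3 v2 v1 v3 = - det3 c1 c2 c3 u1 u2 u3 v1 v2 v3"
  by (simp add: det3_def algebra_simps)

text \<open>Both segments are reversed and then reflected in the centre of the cube. This keeps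
  \<open>u\<close> and \<open>v\<close> and replaces \<open>c\<close> by
  \<open>u - v - c\<close>.\<close>

lemma det3_reverse:
  "det3 (u1 - v1 - c1) (u2 - v2 - c2) (u3 - v3 - c3) u1 u2 u3 v1 v2 v3 = - det3 c1 c2 c3 u1 u2 u3 v1 v2 v3"
  by (simp add: det3_def algebra_simps)

text \<open>The two segments change roles and the third coordinate is reflected; the sign pattern of
  \<open>u\<close> and \<open>v\<close> is preserved.\<close>

lemma det3_exchange:
  "det3 (- c1) (- c2) c3 v1 v2 (- v3) u1 u2 (- u3) = - det3 c1 c2 c3 u1 u2 u3 v1 v2 v3"
  by (simp add: det3_def algebra_simps)

lemma cross_sq_exchange: "cross_sq v1 v2 (- v3) u1 u2 (- u3) = cross_sq u1 u2 u3 v1 v2 v3"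
  by (simp add: cross_sq_def power2_eq_square algebra_simps)

text \<open>The deficits of \<open>u1\<close>, \<open>u2\<close>, \<open>v1\<close>,
  \<open>v2\<close> are \<open>q\<close>, \<open>r\<close>, \<open>t\<close>, \<open>s\<close>;
  those of the third coordinates are 1 and 0. The boxes remove all but eight patterns, four with
  \<open>s = 0\<close> and four with \<open>s = 1\<close>, each of which has its own lemma
  above.\<close>

lemma cross_sq_le_of_det3_sorted:
  fixes k :: int
  assumes k: "2 \<le> k" "k \<noteq> 3"
    and def: "0 \<le> q" "q \<le> k" "0 \<le> r" "r \<le> k" "0 \<le> s" "s \<le> t" "t \<le> k"
    and c: "c1 \<in> {-q..t}" "c2 \<in> {-r..s}"
    and nz: "0 < r + s" "0 < t"
    and D: "\<bar>det3 c1 c2 k (k - q) (k - r) (k - 1) (k - t) (k - s) (- k)\<bar> = 1"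
  shows "cross_sq (k - q) (k - r) (k - 1) (k - t) (k - s) (- k) \<le> kiss_bound k" (is ?small)
proof (rule ccontr)
  assume large: "\<not> ?small"
  note boxes = deficit_check_boxes[THEN cross_sq_le_if_deficits, of k "k - q" "k - r" "k - 1" "k - t" "k - s" "- k"]
  show False
  proof (cases "s = 0")
    case True
    have "1 \<le> r" using nz True def by simp
    have "\<not> 2 \<le> q" using boxes(8) large k def nz True by auto
    moreover have "\<not> (1 \<le> q \<and> 2 \<le> r)" using boxes(9) large k def nz True by auto
    moreover have "\<not> (1 \<le> q \<and> 2 \<le> t)" using boxes(10) large k def nz True by auto
    moreover have "\<not> 3 \<le> r" using boxes(11) large k def nz True by auto
    moreover have "\<not> (2 \<le> r \<and> 3 \<le> t)" using boxes(12) large k def nz True by auto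
    ultimately consider "q = 1" "r = 1" "t = 1" | "q = 0" "r = 1" | "q = 0" "r = 2" "t = 1" | "q = 0" "r = 2" "t = 2"
      using def nz \<open>1 \<le> r\<close> by linarith
    then show False
    proof cases
      case 1
      then show ?thesis using deficit_case_11_10[of k c1 c2] D True large k by simp
    next
      case 2
      then show ?thesis using deficit_case_01_t0[of k t c2 c1] D True large k def nz c by simp
    next
      case 3
      then show ?thesis using deficit_case_02_10[of k c1 c2] D True large k c by simp
    next
      case 4
      then show ?thesis using deficit_case_02_20[of k c1 c2] D True large k c by simp
    qed
  next
    case False
    then have "1 \<le> s" "1 \<le> t" using def by auto
    have s: "\<not> 2 \<le> s" using boxes(13) large k def by auto
    moreover have "\<not> 3 \<le> t" using boxes(14) large k def \<open>1 \<le> s\<close> by auto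
    moreover have "\<not> (1 \<le> q \<and> 1 \<le> r)" using boxes(15) large k def \<open>1 \<le> s\<close> by auto
    moreover have "\<not> 2 \<le> q" using boxes(16) large k def \<open>1 \<le> s\<close> by auto
    moreover have "\<not> 2 \<le> r" using boxes(17) large k def \<open>1 \<le> s\<close> by auto
    moreover have "\<not> (1 \<le> q \<and> 2 \<le> t)" using boxes(18) large k def \<open>1 \<le> s\<close> by auto
    moreover have "\<not> (1 \<le> r \<and> 2 \<le> t)" using boxes(19) large k def \<open>1 \<le> s\<close> by auto
    ultimately consider "q = 0" "r = 0" "t = 1" | "q = 0" "r = 0" "t = 2" | "q = 1" "r = 0" "t = 1" | "q = 0" "r = 1" "t = 1"
      using def \<open>1 \<le> t\<close> by linarith
    moreover have "s = 1" using \<open>1 \<le> s\<close> s by simp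
    ultimately show False
    proof cases
      case 1
      then show ?thesis using deficit_case_00_11[of k c1 c2] D \<open>s = 1\<close> k by simp
    next
      case 2
      then show ?thesis using deficit_case_00_21[of k c1 c2] D \<open>s = 1\<close> large k c by simp
    next
      case 3
      then show ?thesis using deficit_case_10_11[of k c1 c2] D \<open>s = 1\<close> large k c by simp
    next
      case 4
      then show ?thesis using deficit_case_01_11[of k c1 c2] D \<open>s = 1\<close> large k c by simp
    qed
  qed
qed

lemma cross_sq_le_of_det3_c3:
  fixes k :: int
  assumes k: "2 \<le> k" "k \<noteq> 3"
    and u: "u1 \<in> {0..k}" "u2 \<in> {0..k}" and v: "v1 \<in> {0..k}" "v2 \<in> {0..k}"
    and c: "c1 \<in> {u1 - k..k - v1}" "c2 \<in> {u2 - k..k - v2}"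
    and nz: "u1 + v1 < 2 * k" "u2 + v2 < 2 * k" "v1 + v2 < 2 * k"
    and D: "\<bar>det3 c1 c2 k u1 u2 (k - 1) v1 v2 (- k)\<bar> = 1"
  shows "cross_sq u1 u2 (k - 1) v1 v2 (- k) \<le> kiss_bound k"
proof (cases "v1 \<le> v2")
  case True
  then show ?thesis
    using cross_sq_le_of_det3_sorted[of k "k - u1" "k - u2" "k - v2" "k - v1" c1 c2] assms by simp
next
  case False
  then show ?thesis
    using cross_sq_le_of_det3_sorted[of k "k - u2" "k - u1" "k - v1" "k - v2" c2 c1] assms
    by (simp add: det3_swap12[of c2 c1] cross_sq_swap12[of u2 u1])
qed

text \<open>Each of the first two coordinates contributes a positive deficit. If \<open>v3\<close>
  also has one, or if the deficit of \<open>u3\<close> is at least 2, the weighted sum of deficits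
  reaches 6 and one of the first seven boxes applies. This leaves \<open>u3 = k - 1\<close> and
  \<open>v3 = - k\<close>.\<close>

lemma cross_sq_le_of_det3_u3:
  fixes k :: int
  assumes k: "2 \<le> k" "k \<noteq> 3"
    and u: "u1 \<in> {0..k}" "u2 \<in> {0..k}" "u3 \<in> {0..k}" and v: "v1 \<in> {0..k}" "v2 \<in> {0..k}" "v3 \<in> {-k..0}"
    and c: "c1 \<in> {u1 - k..k - v1}" "c2 \<in> {u2 - k..k - v2}" "c3 \<in> {u3 - v3 - k..k}"
    and nz: "u1 + v1 < 2 * k" "u2 + v2 < 2 * k" "v1 < k \<or> v2 < k \<or> - k < v3" "u3 < k"
    and D: "\<bar>det3 c1 c2 c3 u1 u2 u3 v1 v2 v3\<bar> = 1"
  shows "cross_sq u1 u2 u3 v1 v2 v3 \<le> kiss_bound k" (is ?small)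
proof (rule ccontr)
  assume large: "\<not> ?small"
  note boxes = deficit_check_boxes[THEN cross_sq_le_if_deficits, of k u1 u2 u3 v1 v2 v3]
  have "v3 = - k"
  proof (rule ccontr)
    assume "v3 \<noteq> - k"
    then have "1 - k \<le> v3" using v by auto
    have "u1 < k \<or> v1 < k" "u2 < k \<or> v2 < k" using nz by auto
    then show False
    proof (elim disjE)
      assume "u1 < k" "u2 < k"
      then show ?thesis using boxes(1) large k u v nz \<open>1 - k \<le> v3\<close> by auto
    next
      assume "u1 < k" "v2 < k"
      then show ?thesis using boxes(2) large k u v nz \<open>1 - k \<le> v3\<close> by auto
    next
      assume "v1 < k" "u2 < k"
      then show ?thesis using boxes(3) large k u v nz \<open>1 - k \<le> v3\<close> by auto
    next
      assume "v1 < k" "v2 < k"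
      then show ?thesis using boxes(4) large k u v nz \<open>1 - k \<le> v3\<close> by auto
    qed
  qed
  have "u3 = k - 1"
  proof (rule ccontr)
    assume "u3 \<noteq> k - 1"
    then have "u3 \<le> k - 2" using nz by auto
    from nz \<open>v3 = - k\<close> consider "v1 < k" "v2 < k" | "u1 < k" "v2 < k" | "v1 < k" "u2 < k"
      by linarith
    then show False
    proof cases
      case 1
      then show ?thesis using boxes(5) large k u v \<open>u3 \<le> k - 2\<close> by auto
    next
      case 2
      then show ?thesis using boxes(6) large k u v \<open>u3 \<le> k - 2\<close> by auto
    next
      case 3
      then show ?thesis using boxes(7) large k u v \<open>u3 \<le> k - 2\<close> by auto
    qed
  qed
  with \<open>v3 = - k\<close> have uv: "u3 = k - 1" "v3 = - k" by auto
  then have "v1 + v2 < 2 * k" using nz v by auto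
  note * = cross_sq_le_of_det3_c3[OF k u(1,2) v(1,2) _ _ nz(1,2) this]
  from uv c(3) consider "c3 = k" | "c3 = k - 1" by fastforce
  then show False
  proof cases
    case 1
    then show ?thesis using * c D uv large by simp
  next
    case 2
    \<comment> \<open>Reversal turns \<open>c3 = k - 1\<close> into
      \<open>u3 - v3 - c3 = k\<close>.\<close>
    then have "\<bar>det3 (u1 - v1 - c1) (u2 - v2 - c2) k u1 u2 (k - 1) v1 v2 (- k)\<bar> = 1"
      using det3_reverse[of u1 v1 c1 u2 v2 c2 u3 v3 c3] D uv by simp
    then show ?thesis using *[of "u1 - v1 - c1" "u2 - v2 - c2"] c uv large by simp
  qed
qed

text \<open>As \<open>k\<close> does not divide the determinant, neither the vector \<open>u\<close>
  nor \<open>v\<close>, and no coordinate of the triple \<open>c\<close>, \<open>u\<close>,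
  \<open>v\<close>, can consist of multiples of \<open>k\<close>. Each of these five conditions
  yields a positive deficit.\<close>

lemma cross_sq_le_of_abs_det3_eq_1:
  fixes k :: int
  assumes k: "2 \<le> k" "k \<noteq> 3"
    and u: "u1 \<in> {0..k}" "u2 \<in> {0..k}" "u3 \<in> {0..k}" and v: "v1 \<in> {0..k}" "v2 \<in> {0..k}" "v3 \<in> {-k..0}"
    and c: "c1 \<in> {u1 - k..k - v1}" "c2 \<in> {u2 - k..k - v2}" "c3 \<in> {u3 - v3 - k..k}"
    and D: "\<bar>det3 c1 c2 c3 u1 u2 u3 v1 v2 v3\<bar> = 1"
  shows "cross_sq u1 u2 u3 v1 v2 v3 \<le> kiss_bound k"
proof -
  have not_dvd: "\<not> k dvd det3 c1 c2 c3 u1 u2 u3 v1 v2 v3"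
    using abs_det3_eq_1_dvd[OF D, of k] k by auto
  have nz1: "u1 + v1 < 2 * k"
  proof (rule ccontr)
    assume "\<not> ?thesis"
    then have e: "u1 = k" "v1 = k" using u v by auto
    then have "c1 = 0" using c by simp
    then show False using not_dvd unfolding det3_def e by (simp flip: left_diff_distrib right_diff_distrib)
  qed
  have nz2: "u2 + v2 < 2 * k"
  proof (rule ccontr)
    assume "\<not> ?thesis"
    then have e: "u2 = k" "v2 = k" using u v by auto
    then have "c2 = 0" using c by simp
    then show False using not_dvd unfolding det3_def e by (simp flip: left_diff_distrib right_diff_distrib)
  qed
  have nz3: "u3 < k \<or> - k < v3"
  proof (rule ccontr)
    assume "\<not> ?thesis"
    then have e: "u3 = k" "v3 = - k" using u v by auto
    then have "c3 = k" using c by simp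
    then show False using not_dvd unfolding det3_def e by (simp add: dvd_diff dvd_add)
  qed
  have nzu: "u1 < k \<or> u2 < k \<or> u3 < k"
  proof (rule ccontr)
    assume "\<not> ?thesis"
    then have e: "u1 = k" "u2 = k" "u3 = k" using u v by auto
    show False using not_dvd unfolding det3_def e by (simp add: dvd_diff dvd_add)
  qed
  have nzv: "v1 < k \<or> v2 < k \<or> - k < v3"
  proof (rule ccontr)
    assume "\<not> ?thesis"
    then have e: "v1 = k" "v2 = k" "v3 = - k" using u v by auto
    show False using not_dvd unfolding det3_def e by (simp add: dvd_diff dvd_add)
  qed
  show ?thesis
  proof (cases "u3 < k")
    case True
    then show ?thesis using cross_sq_le_of_det3_u3[OF k u v c nz1 nz2 nzv _ D] by simp
  next
    case False
    \<comment> \<open>Now \<open>u3 = k\<close>, hence \<open>- v3 < k\<close>, and exchanging the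
      segments leads back to the first case.\<close>
    then have "cross_sq v1 v2 (- v3) u1 u2 (- u3) \<le> kiss_bound k"
      using u v c nz1 nz2 nz3 nzu D
      by (intro cross_sq_le_of_det3_u3[OF k, of v1 v2 "- v3" u1 u2 "- u3" "- c1" "- c2" c3])
         (auto simp: det3_exchange)
    then show ?thesis by (simp add: cross_sq_exchange)
  qed
qed

section \<open>Reduction to the diagonal octants\<close>

text \<open>One coordinate of two segments in the cube: they start at \<open>a\<close> and
  \<open>b\<close> and have displacements \<open>u\<close> and \<open>v\<close>. Stating this
  separately for each coordinate allows coordinates to be reflected and permuted
  independently.\<close>

definition fits :: "int \<Rightarrow> int \<Rightarrow> int \<Rightarrow> int \<Rightarrow> bool" where
  "fits k u v c \<longleftrightarrow>
    (\<exists>a b. a \<in> {0..k} \<and> a + u \<in> {0..k} \<and> b \<in> {0..k} \<and> b + v \<in> {0..k} \<and> c = b - a)"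

lemma fits_reflect: "fits k u v c \<Longrightarrow> fits k (- u) (- v) (- c)"
  unfolding fits_def
  by (elim exE conjE, rule_tac x = "k - a" in exI, rule_tac x = "k - b" in exI) auto

lemma fits_reverse: "fits k u v c \<Longrightarrow> fits k u (- v) (c + v)"
  unfolding fits_def
  by (elim exE conjE, rule_tac x = "a" in exI, rule_tac x = "b + v" in exI) auto

lemma fits_bounds:
  assumes "fits k u v c"
  shows "u \<in> {-k..k}" "v \<in> {-k..k}"
    "0 \<le> u \<Longrightarrow> 0 \<le> v \<Longrightarrow> c \<in> {u - k..k - v}" "0 \<le> u \<Longrightarrow> v \<le> 0 \<Longrightarrow> c \<in> {u - v - k..k}"
  using assms unfolding fits_def by auto

lemma det3_swap13: "det3 c3 c2 c1 u3 u2 u1 v3 v2 v1 = - det3 c1 c2 c3 u1 u2 u3 v1 v2 v3"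
  by (simp add: det3_def algebra_simps)

lemma det3_swap23: "det3 c1 c3 c2 u1 u3 u2 v1 v3 v2 = - det3 c1 c2 c3 u1 u2 u3 v1 v2 v3"
  by (simp add: det3_def algebra_simps)

lemma cross_sq_swap23: "cross_sq u1 u3 u2 v1 v3 v2 = cross_sq u1 u2 u3 v1 v2 v3"
  by (simp add: cross_sq_def algebra_simps power2_eq_square)

lemma det3_reverse_right:
  "det3 (c1 + v1) (c2 + v2) (c3 + v3) u1 u2 u3 (- v1) (- v2) (- v3) = - det3 c1 c2 c3 u1 u2 u3 v1 v2 v3"
  by (simp add: det3_def algebra_simps)

lemma cross_sq_minus_right: "cross_sq u1 u2 u3 (- v1) (- v2) (- v3) = cross_sq u1 u2 u3 v1 v2 v3"
  by (simp add: cross_sq_def algebra_simps power2_eq_square)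

text \<open>This settles every determinant of absolute value at least 2, whose square is at least
  4.\<close>

lemma cross_sq_le_4_kiss_bound:
  fixes k :: int
  assumes "1 \<le> k" "u1 \<in> {0..k}" "u2 \<in> {0..k}" "u3 \<in> {0..k}" "v1 \<in> {0..k}" "v2 \<in> {0..k}" "v3 \<in> {-k..0}"
  shows "cross_sq u1 u2 u3 v1 v2 v3 \<le> 4 * kiss_bound k"
proof -
  have "\<forall>x1\<in>set [0,[:1,1:]]. \<forall>x2\<in>set [0,[:1,1:]]. \<forall>x3\<in>set [0,[:1,1:]].
     \<forall>y1\<in>set [0,[:1,1:]]. \<forall>y2\<in>set [0,[:1,1:]]. \<forall>y3\<in>set [[:-1,-1:],0].
     \<forall>c\<in>set (coeffs ([:4::int:] * kiss_bound [:1,1:] - cross_sq x1 x2 x3 y1 y2 y3)). 0 \<le> c"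
    by code_simp
  from cross_sq_le_poly_vertices[OF this, of "k - 1" u1 u2 u3 v1 v2 v3] show ?thesis
    using assms by (simp add: poly_kiss_bound)
qed

lemma cross_sq_le_same_sign:
  fixes k :: int
  assumes "1 \<le> k" "u1 \<in> {0..k}" "u2 \<in> {0..k}" "u3 \<in> {0..k}" "v1 \<in> {0..k}" "v2 \<in> {0..k}" "v3 \<in> {0..k}"
  shows "cross_sq u1 u2 u3 v1 v2 v3 \<le> kiss_bound k"
proof (cases "k = 1")
  case True
  have "\<forall>x1\<in>set [0,1]. \<forall>x2\<in>set [0,1]. \<forall>x3\<in>set [0,1].
     \<forall>y1\<in>set [0,1]. \<forall>y2\<in>set [0,1]. \<forall>y3\<in>set [0,1].
     \<forall>c\<in>set (coeffs (kiss_bound [:1::int:] - cross_sq x1 x2 x3 y1 y2 y3)). 0 \<le> c"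
    by code_simp
  from cross_sq_le_poly_vertices[OF this, of 0 u1 u2 u3 v1 v2 v3] show ?thesis
    using assms True by (simp add: poly_kiss_bound)
next
  case False
  \<comment> \<open>The largest vertex value is \<open>3 * k^4\<close>. Expanded around 1, its
    difference to the bound has the coefficient -2 at \<open>j^2\<close>; expanded around 2, all
    coefficients are positive. Hence the separate treatment of \<open>k = 1\<close>.\<close>
  have "\<forall>x1\<in>set [0,[:2,1:]]. \<forall>x2\<in>set [0,[:2,1:]]. \<forall>x3\<in>set [0,[:2,1:]].
     \<forall>y1\<in>set [0,[:2,1:]]. \<forall>y2\<in>set [0,[:2,1:]]. \<forall>y3\<in>set [0,[:2,1:]].
     \<forall>c\<in>set (coeffs (kiss_bound [:2::int,1:] - cross_sq x1 x2 x3 y1 y2 y3)). 0 \<le> c"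
    by code_simp
  from cross_sq_le_poly_vertices[OF this, of "k - 2" u1 u2 u3 v1 v2 v3] show ?thesis
    using assms False by (simp add: poly_kiss_bound)
qed

lemma kiss_bound_pos: "1 \<le> k \<Longrightarrow> 0 < kiss_bound (k::int)"
proof -
  assume "1 \<le> k"
  moreover have "0 \<le> (k - 1) * (k - 1)" "0 \<le> k * (k - 1)" using \<open>1 \<le> k\<close> by auto
  ultimately show ?thesis unfolding kiss_bound_def
    by (intro mult_pos_pos) (auto simp: power2_eq_square algebra_simps)
qed

lemma cross_sq_le_unit_cube:
  assumes "u1 \<in> {0..1}" "u2 \<in> {0..1}" "u3 \<in> {0..1}" "v1 \<in> {0..1}" "v2 \<in> {0..1}" "v3 \<in> {-1..0::int}"
    and "c1 \<in> {u1 - 1..1 - v1}" "c2 \<in> {u2 - 1..1 - v2}" "det3 c1 c2 c3 u1 u2 u3 v1 v2 v3 \<noteq> 0"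
  shows "cross_sq u1 u2 u3 v1 v2 v3 \<le> kiss_bound 1"
proof -
  have "u1 = 0 \<or> u1 = 1" "u2 = 0 \<or> u2 = 1" "u3 = 0 \<or> u3 = 1"
    "v1 = 0 \<or> v1 = 1" "v2 = 0 \<or> v2 = 1" "v3 = -1 \<or> v3 = 0"
    using assms by auto
  \<comment> \<open>The pair of main diagonals has squared cross product 8, above the bound 6, but
    there \<open>c1 = c2 = 0\<close> and the determinant vanishes.\<close>
  moreover have "\<not> (u1 = 1 \<and> u2 = 1 \<and> u3 = 1 \<and> v1 = 1 \<and> v2 = 1 \<and> v3 = -1)"
    using assms by (auto simp: det3_def)
  ultimately show ?thesis
    by (elim disjE) (simp_all add: cross_sq_def kiss_bound_def)
qed

lemma cross_sq_le_det3_opposite: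
  fixes k :: int
  assumes k: "1 \<le> k" "k \<noteq> 3"
    and fit: "fits k u1 v1 c1" "fits k u2 v2 c2" "fits k u3 v3 c3"
    and sgn: "0 \<le> u1" "0 \<le> u2" "0 \<le> u3" "0 \<le> v1" "0 \<le> v2" "v3 \<le> 0"
    and D: "det3 c1 c2 c3 u1 u2 u3 v1 v2 v3 \<noteq> 0"
  shows "cross_sq u1 u2 u3 v1 v2 v3 \<le> kiss_bound k * (det3 c1 c2 c3 u1 u2 u3 v1 v2 v3)\<^sup>2"
proof -
  note b = fits_bounds[OF fit(1)] fits_bounds[OF fit(2)] fits_bounds[OF fit(3)]
  let ?D = "det3 c1 c2 c3 u1 u2 u3 v1 v2 v3"
  show ?thesis
  proof (cases "\<bar>?D\<bar> = 1")
    case True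
    then have "?D\<^sup>2 = 1" by (metis power2_abs power_one)
    moreover have "cross_sq u1 u2 u3 v1 v2 v3 \<le> kiss_bound k"
    proof (cases "k = 1")
      case True
      then show ?thesis using cross_sq_le_unit_cube[of u1 u2 u3 v1 v2 v3 c1 c2 c3] b sgn D by simp
    next
      case False
      then show ?thesis
        using cross_sq_le_of_abs_det3_eq_1[of k u1 u2 u3 v1 v2 v3 c1 c2 c3] k b sgn True by simp
    qed
    ultimately show ?thesis by simp
  next
    case False
    then have "2 \<le> \<bar>?D\<bar>" using D by linarith
    then have "2\<^sup>2 \<le> ?D\<^sup>2" by (metis abs_of_nonneg abs_le_square_iff zero_le_numeral)
    then have "kiss_bound k * 4 \<le> kiss_bound k * ?D\<^sup>2"
      using kiss_bound_pos[OF k(1)] by (intro mult_left_mono) auto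
    moreover have "cross_sq u1 u2 u3 v1 v2 v3 \<le> 4 * kiss_bound k"
      using b sgn k by (intro cross_sq_le_4_kiss_bound) auto
    ultimately show ?thesis by linarith
  qed
qed

text \<open>Two components of \<open>v\<close> have the same sign. Reversing the second segment
  makes them nonnegative if necessary, and a permutation of the coordinates moves the remaining one
  to the third place.\<close>

lemma cross_sq_le_det3_nonneg:
  fixes k :: int
  assumes k: "1 \<le> k" "k \<noteq> 3"
    and fit: "fits k u1 v1 c1" "fits k u2 v2 c2" "fits k u3 v3 c3"
    and u: "0 \<le> u1" "0 \<le> u2" "0 \<le> u3"
    and D: "det3 c1 c2 c3 u1 u2 u3 v1 v2 v3 \<noteq> 0"
  shows "cross_sq u1 u2 u3 v1 v2 v3 \<le> kiss_bound k * (det3 c1 c2 c3 u1 u2 u3 v1 v2 v3)\<^sup>2"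
proof -
  have main: "cross_sq u1 u2 u3 v1 v2 v3 \<le> kiss_bound k * (det3 c1 c2 c3 u1 u2 u3 v1 v2 v3)\<^sup>2"
    if fit: "fits k u1 v1 c1" "fits k u2 v2 c2" "fits k u3 v3 c3"
    and u: "0 \<le> u1" "0 \<le> u2" "0 \<le> u3"
    and D: "det3 c1 c2 c3 u1 u2 u3 v1 v2 v3 \<noteq> 0"
    and v: "0 \<le> v1 \<and> 0 \<le> v2 \<or> 0 \<le> v1 \<and> 0 \<le> v3 \<or> 0 \<le> v2 \<and> 0 \<le> v3"
    for u1 u2 u3 v1 v2 v3 c1 c2 c3
  proof -
    consider "0 \<le> v1" "0 \<le> v2" "0 \<le> v3" | "0 \<le> v1" "0 \<le> v2" "v3 \<le> 0"
      | "0 \<le> v1" "v2 \<le> 0" "0 \<le> v3" | "v1 \<le> 0" "0 \<le> v2" "0 \<le> v3"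
      using v by linarith
    then show ?thesis
    proof cases
      case 1
      then have "cross_sq u1 u2 u3 v1 v2 v3 \<le> kiss_bound k"
        using fits_bounds[OF fit(1)] fits_bounds[OF fit(2)] fits_bounds[OF fit(3)] k u
        by (intro cross_sq_le_same_sign) auto
      also have "\<dots> \<le> kiss_bound k * (det3 c1 c2 c3 u1 u2 u3 v1 v2 v3)\<^sup>2"
        using kiss_bound_pos[OF k(1)] D by (simp add: int_one_le_iff_zero_less)
      finally show ?thesis .
    next
      case 2
      then show ?thesis using cross_sq_le_det3_opposite[OF k fit] u D by simp
    next
      case 3
      then show ?thesis using cross_sq_le_det3_opposite[OF k fit(1,3,2)] u D
        by (simp add: det3_swap23[of c1 c3] cross_sq_swap23[of u1 u3])
    next
      case 4
      then show ?thesis using cross_sq_le_det3_opposite[OF k fit(3,2,1)] u D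
        by (simp add: det3_swap13[of c3 c2] cross_sq_swap13[of u3 u2])
    qed
  qed
  show ?thesis
  proof (cases "0 \<le> v1 \<and> 0 \<le> v2 \<or> 0 \<le> v1 \<and> 0 \<le> v3 \<or> 0 \<le> v2 \<and> 0 \<le> v3")
    case True
    then show ?thesis using main fit u D by blast
  next
    case False
    then have "0 \<le> - v1 \<and> 0 \<le> - v2 \<or> 0 \<le> - v1 \<and> 0 \<le> - v3 \<or> 0 \<le> - v2 \<and> 0 \<le> - v3" by auto
    then show ?thesis
      using main[OF fit[THEN fits_reverse] u] D by (simp add: det3_reverse_right cross_sq_minus_right)
  qed
qed

text \<open>Reflecting single coordinates makes \<open>u\<close> nonnegative; it changes the
  determinant and the components of the cross product only in sign.\<close>

lemma cross_sq_le_det3: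
  fixes k :: int
  assumes k: "1 \<le> k" "k \<noteq> 3"
    and fit: "fits k u1 v1 c1" "fits k u2 v2 c2" "fits k u3 v3 c3"
    and D: "det3 c1 c2 c3 u1 u2 u3 v1 v2 v3 \<noteq> 0"
  shows "cross_sq u1 u2 u3 v1 v2 v3 \<le> kiss_bound k * (det3 c1 c2 c3 u1 u2 u3 v1 v2 v3)\<^sup>2"
proof -
  have reflect: "\<exists>v' c'. fits k \<bar>u\<bar> v' c' \<and> (\<exists>s\<in>{1,-1}. \<bar>u\<bar> = s * u \<and> v' = s * v \<and> c' = s * c)"
    if "fits k u v c" for u v c
    using that fits_reflect[OF that] by (cases "0 \<le> u") auto
  obtain s1 s2 s3 where s: "s1 \<in> {1,-1}" "s2 \<in> {1,-1}" "s3 \<in> {1,-1}"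
    and "fits k \<bar>u1\<bar> (s1 * v1) (s1 * c1)" "fits k \<bar>u2\<bar> (s2 * v2) (s2 * c2)" "fits k \<bar>u3\<bar> (s3 * v3) (s3 * c3)"
    and u: "\<bar>u1\<bar> = s1 * u1" "\<bar>u2\<bar> = s2 * u2" "\<bar>u3\<bar> = s3 * u3"
    using fit[THEN reflect] by metis
  note fit' = this(4-6)
  have "(det3 (s1 * c1) (s2 * c2) (s3 * c3) (s1 * u1) (s2 * u2) (s3 * u3) (s1 * v1) (s2 * v2) (s3 * v3))\<^sup>2
      = (det3 c1 c2 c3 u1 u2 u3 v1 v2 v3)\<^sup>2"
    "cross_sq (s1 * u1) (s2 * u2) (s3 * u3) (s1 * v1) (s2 * v2) (s3 * v3) = cross_sq u1 u2 u3 v1 v2 v3"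
    using s by (auto simp: det3_def cross_sq_def power2_eq_square algebra_simps)
  then show ?thesis
    using cross_sq_le_det3_nonneg[OF k fit'] D unfolding u
    by (metis abs_ge_zero u zero_eq_power2)
qed

section \<open>Lower bound on the distance\<close>

lemma of_int_cross_sq: "of_int (cross_sq u1 u2 u3 v1 v2 v3) =
    cross_sq (of_int u1) (of_int u2) (of_int u3) (of_int v1) (of_int v2) (of_int v3)"
  by (simp add: cross_sq_def)

lemma of_int_det3: "of_int (det3 c1 c2 c3 u1 u2 u3 v1 v2 v3) =
    det3 (of_int c1) (of_int c2) (of_int c3) (of_int u1) (of_int u2) (of_int u3) (of_int v1) (of_int v2) (of_int v3)"
  by (simp add: det3_def)

lemma of_int_kiss_bound: "of_int (kiss_bound k) = kiss_bound (of_int k)"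
  by (simp add: kiss_bound_def)

lemma norm_sq_3: "(norm (x :: real^3))\<^sup>2 = (x$1)\<^sup>2 + (x$2)\<^sup>2 + (x$3)\<^sup>2"
  unfolding power2_norm_eq_inner by (simp add: inner_vec_def sum_3 power2_eq_square)

lemma norm_cross3_sq: "(norm (cross3 x y))\<^sup>2 = cross_sq (x$1) (x$2) (x$3) (y$1) (y$2) (y$3)"
  by (simp add: norm_sq_3 cross_components cross_sq_def mult.commute)

lemma inner_cross3: "w \<bullet> cross3 x y = det3 (w$1) (w$2) (w$3) (x$1) (x$2) (x$3) (y$1) (y$2) (y$3)"
  by (simp add: inner_vec_def sum_3 cross_components det3_def algebra_simps)

text \<open>The three estimates serve the degenerate positions: a triangle in one face, parallel
  faces, and two vertices.\<close>

lemma kiss_bound_nat_ge: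
  fixes k :: nat
  assumes "0 < k"
  shows "3 * real k ^ 4 \<le> kiss_bound (real k)" "3 * (real k)\<^sup>2 \<le> kiss_bound (real k)" "1 \<le> kiss_bound (real k)"
proof -
  have k1: "1 \<le> real k" using assms by simp
  show a: "3 * real k ^ 4 \<le> kiss_bound (real k)"
  proof (cases "k = 1")
    case True
    then show ?thesis by (simp add: kiss_bound_def)
  next
    case False
    define j where "j = real k - 2"
    have j: "0 \<le> j" "real k = j + 2" using False assms by (auto simp: j_def)
    have "kiss_bound (real k) - 3 * real k ^ 4 = 5 * j ^ 4 + 16 * j ^ 3 + 16 * j\<^sup>2 + 4 * j + 2"
      unfolding kiss_bound_def j by algebra
    moreover have "0 \<le> j ^ 4" "0 \<le> j ^ 3" "0 \<le> j\<^sup>2" using j(1) by simp_all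
    ultimately show ?thesis using j(1) by linarith
  qed
  have "(real k)\<^sup>2 \<le> real k ^ 4" "1 \<le> real k ^ 4"
    using k1 by (auto intro: power_increasing)
  then show "3 * (real k)\<^sup>2 \<le> kiss_bound (real k)" "1 \<le> kiss_bound (real k)"
    using a by auto
qed

lemma Ints_sq_ge_1:
  fixes r :: real
  assumes "r \<in> \<int>" "r \<noteq> 0"
  shows "1 \<le> r\<^sup>2"
  using assms by (metis Ints_nonzero_abs_ge1 abs_square_le_1 linorder_not_less nle_le one_power2 power2_abs)

lemma Ints_vec_norm_sq_ge_1:
  fixes x :: "real^'n"
  assumes "\<And>i. x $ i \<in> \<int>" "x \<noteq> 0"
  shows "1 \<le> (norm x)\<^sup>2"
proof -
  obtain i where "x $ i \<noteq> 0" using assms(2) by (auto simp: vec_eq_iff)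
  then have "1 \<le> (x $ i)\<^sup>2" using Ints_sq_ge_1[OF assms(1)] by simp
  also have "\<dots> \<le> (norm x)\<^sup>2"
    using component_le_norm_cart[of x i] by (metis abs_ge_zero power2_abs power_mono)
  finally show ?thesis .
qed

lemma Ints_cross3:
  assumes "\<And>i. x $ i \<in> \<int>" "\<And>i. y $ i \<in> \<int>"
  shows "cross3 x y $ i \<in> \<int>"
  using exhaust_3[of i] assms by (auto simp: cross_components intro!: Ints_diff Ints_mult)

lemma Ints_inner3:
  fixes x y :: "real^3"
  assumes "\<And>i. x $ i \<in> \<int>" "\<And>i. y $ i \<in> \<int>"
  shows "x \<bullet> y \<in> \<int>"
  using assms by (auto simp: inner_vec_def sum_3 intro!: Ints_add Ints_mult)

lemma lattice_box_Ints: "x \<in> lattice_box k \<Longrightarrow> x $ i \<in> \<int>"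
  by (simp add: lattice_box_def)

lemma lattice_box_fits:
  assumes "a \<in> lattice_box k" "a' \<in> lattice_box k" "b \<in> lattice_box k" "b' \<in> lattice_box k"
  shows "\<exists>u v c. fits (int k) u v c \<and> (a' - a) $ i = of_int u \<and> (b' - b) $ i = of_int v \<and> (b - a) $ i = of_int c"
proof -
  have "\<exists>m. x $ i = of_int m \<and> m \<in> {0..int k}" if x: "x \<in> lattice_box k" for x :: "real^'a"
  proof -
    obtain m where "x $ i = of_int m" using lattice_box_Ints[OF x] Ints_cases by metis
    moreover have "0 \<le> x $ i" "x $ i \<le> real k" using x by (auto simp: lattice_box_def)
    ultimately show ?thesis by (intro exI[of _ m]) simp
  qed
  then obtain m m' n n' where m: "a $ i = of_int m" "m \<in> {0..int k}" "a' $ i = of_int m'" "m' \<in> {0..int k}"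
      "b $ i = of_int n" "n \<in> {0..int k}" "b' $ i = of_int n'" "n' \<in> {0..int k}"
    using assms by metis
  have "fits (int k) (m' - m) (n' - n) (n - m)"
    unfolding fits_def using m by (intro exI[of _ m] exI[of _ n]) auto
  then show ?thesis using m by (intro exI[of _ "m' - m"] exI[of _ "n' - n"] exI[of _ "n - m"]) simp
qed

lemma norm_cross3_le_segments:
  fixes a a' b b' :: "real^3"
  assumes "a \<in> lattice_box k" "a' \<in> lattice_box k" "b \<in> lattice_box k" "b' \<in> lattice_box k"
    and "0 < k" "k \<noteq> 3" "(b - a) \<bullet> cross3 (a' - a) (b' - b) \<noteq> 0"
  shows "(norm (cross3 (a' - a) (b' - b)))\<^sup>2 \<le> kiss_bound (real k) * ((b - a) \<bullet> cross3 (a' - a) (b' - b))\<^sup>2"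
proof -
  obtain u v c where fits: "\<And>i. fits (int k) (u i) (v i) (c i)"
    and eq: "\<And>i. (a' - a) $ i = of_int (u i)" "\<And>i. (b' - b) $ i = of_int (v i)" "\<And>i. (b - a) $ i = of_int (c i)"
    using lattice_box_fits[OF assms(1-4)] by metis
  let ?N = "cross_sq (u 1) (u 2) (u 3) (v 1) (v 2) (v 3)"
  let ?D = "det3 (c 1) (c 2) (c 3) (u 1) (u 2) (u 3) (v 1) (v 2) (v 3)"
  have N: "(norm (cross3 (a' - a) (b' - b)))\<^sup>2 = of_int ?N"
    by (simp only: norm_cross3_sq of_int_cross_sq eq)
  have D: "(b - a) \<bullet> cross3 (a' - a) (b' - b) = of_int ?D"
    by (simp only: inner_cross3 of_int_det3 eq)
  have "?N \<le> kiss_bound (int k) * ?D\<^sup>2"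
    using assms(5-7) fits by (intro cross_sq_le_det3) (auto simp: D)
  then have "real_of_int ?N \<le> of_int (kiss_bound (int k) * ?D\<^sup>2)"
    by (rule of_int_le_iff[THEN iffD2])
  then show ?thesis
    unfolding N D by (simp add: of_int_kiss_bound)
qed

section \<open>Triangles, common normals and the faces of closest points\<close>

lemma planar_triangle_le:
  fixes x0 x1 x2 y0 y1 y2 k :: real
  assumes "x0 \<in> {0..k}" "x1 \<in> {0..k}" "x2 \<in> {0..k}" "y0 \<in> {0..k}" "y1 \<in> {0..k}" "y2 \<in> {0..k}"
  shows "((x1 - x0) * (y2 - y0) - (x2 - x0) * (y1 - y0))\<^sup>2 \<le> k ^ 4"
proof -
  have le: "(x1 - x0) * (y2 - y0) - (x2 - x0) * (y1 - y0) \<le> k\<^sup>2"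
    if "x0 \<in> {0..k}" "x1 \<in> {0..k}" "x2 \<in> {0..k}" "y0 \<in> {0..k}" "y1 \<in> {0..k}" "y2 \<in> {0..k}"
    for x0 x1 x2 y0 y1 y2
  proof -
    have m: "x * d \<le> k * max d 0" if "x \<in> {0..k}" for x d
      using that by (cases "0 \<le> d") (auto simp: max_def mult_right_mono mult_nonneg_nonpos)
    \<comment> \<open>The expression is twice a signed area. Each \<open>x\<close> is at most
      \<open>k\<close>, and the positive parts of the cyclic differences of the \<open>y\<close> add
      up to their maximum minus their minimum.\<close>
    have "(x1 - x0) * (y2 - y0) - (x2 - x0) * (y1 - y0)
        = x0 * (y1 - y2) + x1 * (y2 - y0) + x2 * (y0 - y1)"
      by algebra
    also have "\<dots> \<le> k * (max (y1 - y2) 0 + max (y2 - y0) 0 + max (y0 - y1) 0)"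
      using m[of x0 "y1 - y2"] m[of x1 "y2 - y0"] m[of x2 "y0 - y1"] that by (simp add: distrib_left)
    also have "\<dots> \<le> k * k"
      using that by (intro mult_left_mono) (auto simp: max_def)
    finally show ?thesis by (simp add: power2_eq_square)
  qed
  have "\<bar>(x1 - x0) * (y2 - y0) - (x2 - x0) * (y1 - y0)\<bar> \<le> k\<^sup>2"
    using le[OF assms] le[OF assms(1,3,2,4,6,5)] by (simp add: abs_le_iff algebra_simps)
  then have "((x1 - x0) * (y2 - y0) - (x2 - x0) * (y1 - y0))\<^sup>2 \<le> (k\<^sup>2)\<^sup>2"
    by (metis abs_ge_zero power2_abs power_mono)
  then show ?thesis by simp
qed

lemma norm_cross3_le_triangle:
  fixes a b c :: "real^3"
  assumes "a \<in> lattice_box k" "b \<in> lattice_box k" "c \<in> lattice_box k"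
  shows "(norm (cross3 (b - a) (c - a)))\<^sup>2 \<le> 3 * real k ^ 4"
proof -
  have box: "x $ i \<in> {0..real k}" if "x \<in> lattice_box k" for x :: "real^3" and i
    using that by (simp add: lattice_box_def)
  note le = planar_triangle_le[OF assms[THEN box] assms[THEN box]]
  show ?thesis
    unfolding norm_sq_3 cross_components
    using le[of 2 2 3 3 2 3] le[of 3 3 1 1 3 1] le[of 1 1 2 2 1 2] by simp
qed

text \<open>\<open>\<delta>\<close> is parallel to \<open>n\<close>, and by the condition on
  \<open>w\<close> it is the orthogonal projection of \<open>w\<close> to this direction. Its length
  is therefore \<open>\<bar>w \<bullet> n\<bar> / norm n\<close>.\<close>

lemma common_normal:
  fixes \<delta> u v w :: "real^3"
  defines "n \<equiv> cross3 u v"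
  assumes orth: "\<delta> \<bullet> u = 0" "\<delta> \<bullet> v = 0" and "n \<noteq> 0" "\<delta> \<noteq> 0" and w: "w \<bullet> \<delta> = \<delta> \<bullet> \<delta>"
  shows "(norm \<delta>)\<^sup>2 * (norm n)\<^sup>2 = (w \<bullet> n)\<^sup>2" "w \<bullet> n \<noteq> 0"
proof -
  have "cross3 \<delta> n = 0"
    unfolding n_def by (simp add: Lagrange orth)
  then have par: "(n \<bullet> n) *\<^sub>R \<delta> = (n \<bullet> \<delta>) *\<^sub>R n"
    using Lagrange[of n \<delta> n] by simp
  have 1: "(n \<bullet> n) * (\<delta> \<bullet> \<delta>) = (n \<bullet> \<delta>)\<^sup>2"
    using arg_cong[OF par, of "\<lambda>x. x \<bullet> \<delta>"] by (simp add: power2_eq_square)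
  have 2: "(n \<bullet> n) * (\<delta> \<bullet> \<delta>) = (n \<bullet> \<delta>) * (w \<bullet> n)"
    using arg_cong[OF par, of "\<lambda>x. w \<bullet> x"] w by simp
  have "n \<bullet> \<delta> \<noteq> 0" using 1 assms by auto
  then have eq: "w \<bullet> n = n \<bullet> \<delta>"
    using 1 2 by (simp add: power2_eq_square)
  show "w \<bullet> n \<noteq> 0" using eq \<open>n \<bullet> \<delta> \<noteq> 0\<close> by simp
  show "(norm \<delta>)\<^sup>2 * (norm n)\<^sup>2 = (w \<bullet> n)\<^sup>2"
    using 1 by (simp add: eq power2_norm_eq_inner mult.commute)
qed

text \<open>The minimum of a linear functional over a polytope is attained on a face, and a face is
  the hull of the generators it contains.\<close>

lemma in_convex_hull_face:
  fixes S :: "(real^'n) set"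
  assumes "finite S" "p \<in> convex hull S" "\<And>s. s \<in> S \<Longrightarrow> d \<bullet> p \<le> d \<bullet> s"
  shows "p \<in> convex hull {s \<in> S. d \<bullet> s = d \<bullet> p}"
proof -
  have "convex {x. d \<bullet> p \<le> d \<bullet> x}" by (rule convex_halfspace_ge)
  then have "convex hull S \<subseteq> {x. d \<bullet> p \<le> d \<bullet> x}"
    using assms(3) by (intro hull_minimal) auto
  then have "(convex hull S \<inter> {x. d \<bullet> x = d \<bullet> p}) face_of convex hull S"
    by (intro face_of_Int_supporting_hyperplane_ge) auto
  then obtain S' where S': "S' \<subseteq> S" "convex hull S \<inter> {x. d \<bullet> x = d \<bullet> p} = convex hull S'"
    using face_of_convex_hull_subset finite_imp_compact[OF assms(1)] by metis
  have "S' \<subseteq> {s \<in> S. d \<bullet> s = d \<bullet> p}"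
    using S' hull_subset[of S' convex] by auto
  moreover have "p \<in> convex hull S'" using S'(2) assms(2) by auto
  ultimately show ?thesis using hull_mono by blast
qed

lemma cross3_hull_parallel:
  assumes "p \<in> convex hull S" "\<And>s. s \<in> S \<Longrightarrow> cross3 (s - a) u = 0"
  shows "cross3 (p - a) u = 0"
proof -
  have "convex {x. cross3 (x - a) u = 0}"
  proof (rule convexI)
    fix x y :: "real^3" and r s :: real
    assume "x \<in> {x. cross3 (x - a) u = 0}" "y \<in> {x. cross3 (x - a) u = 0}" "r + s = 1"
    moreover from \<open>r + s = 1\<close> have "r *\<^sub>R x + s *\<^sub>R y - a = r *\<^sub>R (x - a) + s *\<^sub>R (y - a)"
      by (simp add: algebra_simps flip: scaleR_left.add)
    ultimately show "r *\<^sub>R x + s *\<^sub>R y \<in> {x. cross3 (x - a) u = 0}"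
      by (simp add: cross_add_left cross_mult_left)
  qed
  then show ?thesis
    using hull_minimal[of S "{x. cross3 (x - a) u = 0}" convex] assms by auto
qed

lemma norm_lattice_box_diff:
  fixes a b :: "real^3"
  assumes "a \<in> lattice_box k" "b \<in> lattice_box k"
  shows "(norm (b - a))\<^sup>2 \<le> 3 * (real k)\<^sup>2"
proof -
  have "((b - a) $ i)\<^sup>2 \<le> (real k)\<^sup>2" for i
    using assms by (intro abs_le_square_iff[THEN iffD1]) (auto simp: lattice_box_def abs_le_iff algebra_simps add_increasing2)
  from this[of 1] this[of 2] this[of 3] show ?thesis
    unfolding norm_sq_3 by linarith
qed

text \<open>\<open>S0\<close> and \<open>T0\<close> are the generators in the planes through
  \<open>p\<close> and \<open>q\<close> orthogonal to \<open>\<delta>\<close>. Two independent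
  differences within these sets fix the direction of \<open>\<delta>\<close>, and
  \<open>common_normal\<close> gives its length. Otherwise the distance is that of two parallel
  lattice lines or of two lattice points.\<close>

lemma kiss_bound_separation:
  fixes S T :: "(real^3) set"
  assumes k: "0 < k" "k \<noteq> 3"
    and S: "finite S" "S \<subseteq> lattice_box k" and T: "finite T" "T \<subseteq> lattice_box k"
    and p: "p \<in> convex hull S" and q: "q \<in> convex hull T" and "p \<noteq> q"
    and closest: "\<And>p' q'. p' \<in> convex hull S \<Longrightarrow> q' \<in> convex hull T \<Longrightarrow> norm (p - q) \<le> norm (p' - q')"
  shows "1 \<le> kiss_bound (real k) * (norm (p - q))\<^sup>2"
proof -
  define \<delta> where "\<delta> = p - q"
  define S0 where "S0 = {s \<in> S. \<delta> \<bullet> s = \<delta> \<bullet> p}"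
  define T0 where "T0 = {t \<in> T. - \<delta> \<bullet> t = - \<delta> \<bullet> q}"
  have "\<delta> \<noteq> 0" using \<open>p \<noteq> q\<close> by (simp add: \<delta>_def)
  have closed: "closed (convex hull S)" "closed (convex hull T)"
    using S T by (simp_all add: finite_imp_compact_convex_hull compact_imp_closed)
  \<comment> \<open>As \<open>p\<close> is the point of its hull closest to \<open>q\<close>, no
    \<open>s - p\<close> makes an acute angle with \<open>q - p\<close>.\<close>
  have "- \<delta> \<bullet> (s - p) \<le> 0" if "s \<in> S" for s
    using closest[OF _ q] hull_inc[OF that, of convex] closed p
    unfolding \<delta>_def minus_diff_eq
    by (intro any_closest_point_dot[of "convex hull S"]) (auto simp: dist_norm norm_minus_commute)
  then have "\<delta> \<bullet> p \<le> \<delta> \<bullet> s" if "s \<in> S" for s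
    using that by (simp add: inner_diff_right)
  then have pS0: "p \<in> convex hull S0"
    unfolding S0_def using S p by (intro in_convex_hull_face) auto
  have "\<delta> \<bullet> (t - q) \<le> 0" if "t \<in> T" for t
    using closest[OF p] hull_inc[OF that, of convex] closed q
    unfolding \<delta>_def by (intro any_closest_point_dot[of "convex hull T"]) (auto simp: dist_norm)
  then have "- \<delta> \<bullet> q \<le> - \<delta> \<bullet> t" if "t \<in> T" for t
    using that by (simp add: inner_diff_right)
  then have qT0: "q \<in> convex hull T0"
    unfolding T0_def using T q by (intro in_convex_hull_face) auto
  obtain s0 t0 where s0: "s0 \<in> S0" and t0: "t0 \<in> T0"
    using pS0 qT0 by fastforce
  have box: "x \<in> lattice_box k" if "x \<in> S0 \<union> T0" for x
    using that S T by (auto simp: S0_def T0_def)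
  have Sorth: "\<delta> \<bullet> (s - s0) = 0" if "s \<in> S0" for s
    using that s0 by (simp add: S0_def inner_diff_right)
  have Torth: "\<delta> \<bullet> (t - t0) = 0" if "t \<in> T0" for t
    using that t0 by (simp add: T0_def inner_diff_right)
  have w: "(s0 - t0) \<bullet> \<delta> = \<delta> \<bullet> \<delta>"
    using s0 t0 by (simp add: S0_def T0_def \<delta>_def inner_diff_right inner_diff_left inner_commute)
  have wInt: "(s0 - t0) $ i \<in> \<int>" for i
    using s0 t0 by (auto intro!: Ints_diff lattice_box_Ints[OF box])
  have normal: ?thesis
    if "\<delta> \<bullet> u = 0" "\<delta> \<bullet> v = 0" "cross3 u v \<noteq> 0"
      and le: "(s0 - t0) \<bullet> cross3 u v \<noteq> 0 \<Longrightarrow>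
        (norm (cross3 u v))\<^sup>2 \<le> kiss_bound (real k) * ((s0 - t0) \<bullet> cross3 u v)\<^sup>2" for u v
  proof -
    note n = common_normal[OF that(1-3) \<open>\<delta> \<noteq> 0\<close> w]
    have "(norm (cross3 u v))\<^sup>2 * 1 \<le> (norm (cross3 u v))\<^sup>2 * (kiss_bound (real k) * (norm \<delta>)\<^sup>2)"
      using le[OF n(2)] unfolding n(1)[symmetric] by (simp add: mult_ac)
    then show ?thesis
      using that(3) unfolding \<delta>_def[symmetric] by (subst (asm) mult_le_cancel_left_pos) auto
  qed
  have triangle: ?thesis
    if "\<delta> \<bullet> (y - x) = 0" "\<delta> \<bullet> (z - x) = 0" "cross3 (y - x) (z - x) \<noteq> 0"
      and xyz: "{x, y, z} \<subseteq> S0 \<union> T0" for x y z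
  proof (rule normal[OF that(1-3)])
    let ?n = "cross3 (y - x) (z - x)"
    assume "(s0 - t0) \<bullet> ?n \<noteq> 0"
    moreover have "(s0 - t0) \<bullet> ?n \<in> \<int>"
      using xyz by (intro Ints_inner3 Ints_cross3 wInt) (auto intro!: Ints_diff lattice_box_Ints[OF box])
    ultimately have "1 \<le> ((s0 - t0) \<bullet> ?n)\<^sup>2" by (intro Ints_sq_ge_1)
    then have "kiss_bound (real k) * 1 \<le> kiss_bound (real k) * ((s0 - t0) \<bullet> ?n)\<^sup>2"
      using kiss_bound_nat_ge(3)[OF k(1)] by (intro mult_left_mono) auto
    moreover have "(norm ?n)\<^sup>2 \<le> kiss_bound (real k)"
      using norm_cross3_le_triangle[of x k y z] kiss_bound_nat_ge(1)[OF k(1)] xyz box by fastforce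
    ultimately show "(norm ?n)\<^sup>2 \<le> kiss_bound (real k) * ((s0 - t0) \<bullet> ?n)\<^sup>2" by simp
  qed
  consider (S) s s' where "s \<in> S0" "s' \<in> S0" "cross3 (s - s0) (s' - s0) \<noteq> 0"
    | (T) t t' where "t \<in> T0" "t' \<in> T0" "cross3 (t - t0) (t' - t0) \<noteq> 0"
    | (ST) s t where "s \<in> S0" "t \<in> T0" "cross3 (s - s0) (t - t0) \<noteq> 0"
    | (parallel) "\<And>s s'. s \<in> S0 \<Longrightarrow> s' \<in> S0 \<Longrightarrow> cross3 (s - s0) (s' - s0) = 0"
        "\<And>t t'. t \<in> T0 \<Longrightarrow> t' \<in> T0 \<Longrightarrow> cross3 (t - t0) (t' - t0) = 0"
        "\<And>s t. s \<in> S0 \<Longrightarrow> t \<in> T0 \<Longrightarrow> cross3 (s - s0) (t - t0) = 0"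
    by metis
  then show ?thesis
  proof cases
    case S
    then show ?thesis using triangle[of s s0 s'] Sorth s0 by auto
  next
    case T
    then show ?thesis using triangle[of t t0 t'] Torth t0 by auto
  next
    case ST
    show ?thesis
    proof (rule normal[OF Sorth[OF ST(1)] Torth[OF ST(2)] ST(3)])
      let ?n = "cross3 (s - s0) (t - t0)"
      assume "(s0 - t0) \<bullet> ?n \<noteq> 0"
      moreover have "(t0 - s0) \<bullet> ?n = - ((s0 - t0) \<bullet> ?n)"
        by (simp add: inner_diff_left)
      ultimately show "(norm ?n)\<^sup>2 \<le> kiss_bound (real k) * ((s0 - t0) \<bullet> ?n)\<^sup>2"
        using norm_cross3_le_segments[of s0 k s t0 t] k box ST s0 t0 by simp
    qed
  next
    case parallel
    have "cross3 (t - t0) (s - s0) = 0" if "s \<in> S0" "t \<in> T0" for s t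
      using parallel(3)[OF that] cross_skew[of "t - t0"] by simp
    note parallel = parallel this
    show ?thesis
    proof (cases "\<exists>u \<in> (\<lambda>s. s - s0) ` S0 \<union> (\<lambda>t. t - t0) ` T0. u \<noteq> 0")
      case True
      then obtain u where u: "u \<in> (\<lambda>s. s - s0) ` S0 \<union> (\<lambda>t. t - t0) ` T0" "u \<noteq> 0" by blast
      then have "\<delta> \<bullet> u = 0" using Sorth Torth by auto
      obtain x y where xy: "x \<in> S0 \<union> T0" "y \<in> S0 \<union> T0" "u = x - y"
        using u s0 t0 by auto
      have "cross3 (p - s0) u = 0"
        using u parallel by (intro cross3_hull_parallel[OF pS0]) auto
      moreover have "cross3 (q - t0) u = 0"
        using u parallel by (intro cross3_hull_parallel[OF qT0]) auto
      \<comment> \<open>The parts \<open>p - s0\<close> and \<open>q - t0\<close> are parallel to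
        \<open>u\<close> and vanish in the product with \<open>u\<close>, which leaves an integer
        vector.\<close>
      moreover have "\<delta> = (p - s0) - (q - t0) + (s0 - t0)" by (simp add: \<delta>_def)
      ultimately have \<delta>u: "cross3 \<delta> u = cross3 (s0 - t0) u"
        by (simp only: cross_add_left Cross3.left_diff_distrib) simp
      have n: "(norm (cross3 \<delta> u))\<^sup>2 = (norm \<delta>)\<^sup>2 * (norm u)\<^sup>2"
        using norm_cross_dot[of \<delta> u] \<open>\<delta> \<bullet> u = 0\<close> by (simp add: power_mult_distrib)
      then have "cross3 \<delta> u \<noteq> 0" using \<open>\<delta> \<noteq> 0\<close> u by auto
      moreover have "u $ i \<in> \<int>" for i
        unfolding xy vector_minus_component by (intro Ints_diff lattice_box_Ints[OF box] xy)
      ultimately have "1 \<le> (norm (cross3 \<delta> u))\<^sup>2"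
        unfolding \<delta>u by (intro Ints_vec_norm_sq_ge_1 Ints_cross3 wInt)
      also have "\<dots> \<le> (norm \<delta>)\<^sup>2 * kiss_bound (real k)"
      proof -
        have "(norm u)\<^sup>2 \<le> 3 * (real k)\<^sup>2"
          unfolding xy(3) using box xy by (intro norm_lattice_box_diff)
        then show ?thesis
          unfolding n using kiss_bound_nat_ge(2)[OF k(1)] by (intro mult_left_mono) auto
      qed
      finally show ?thesis by (simp add: \<delta>_def mult.commute)
    next
      case False
      then have "s - s0 = 0" if "s \<in> S0" for s using that by blast
      moreover have "t - t0 = 0" if "t \<in> T0" for t using False that by blast
      ultimately have "S0 \<subseteq> {s0}" "T0 \<subseteq> {t0}" by auto
      then have "convex hull S0 \<subseteq> {s0}" "convex hull T0 \<subseteq> {t0}"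
        by (intro hull_minimal; simp)+
      then have "p = s0" "q = t0" using pS0 qT0 by auto
      then have "1 * 1 \<le> kiss_bound (real k) * (norm (p - q))\<^sup>2"
        using wInt \<open>p \<noteq> q\<close> kiss_bound_nat_ge(3)[OF k(1)]
        by (intro mult_mono Ints_vec_norm_sq_ge_1) auto
      then show ?thesis by simp
    qed
  qed
qed

section \<open>Segments attaining the bound\<close>

text \<open>The functional \<open>x \<mapsto> n \<bullet> x\<close> with \<open>n\<close> the cross
  product of the directions is constant on each segment. The two constants differ by the
  determinant, so the segments are disjoint.\<close>

lemma epsilon_le_segments:
  fixes a a' b b' :: "real^3"
  assumes "a \<in> lattice_box k" "a' \<in> lattice_box k" "b \<in> lattice_box k" "b' \<in> lattice_box k"
    and D: "(b - a) \<bullet> cross3 (a' - a) (b' - b) \<noteq> 0"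
    and "p \<in> closed_segment a a'" "q \<in> closed_segment b b'"
  shows "epsilon TYPE(3) k \<le> norm (p - q)"
proof -
  let ?n = "cross3 (a' - a) (b' - b)"
  have seg: "n \<bullet> x = n \<bullet> c" if x: "x \<in> closed_segment c d" "n \<bullet> (d - c) = 0" for n x c d :: "real^3"
  proof -
    obtain u where "x = (1 - u) *\<^sub>R c + u *\<^sub>R d" using x(1) by (auto simp: in_segment)
    moreover have "n \<bullet> d = n \<bullet> c" using x(2) by (simp add: inner_diff_right)
    ultimately show ?thesis by (simp add: inner_add_right left_diff_distrib)
  qed
  have "closed_segment a a' \<inter> closed_segment b b' = {}"
  proof (rule ccontr)
    assume "\<not> ?thesis"
    then obtain x where "x \<in> closed_segment a a'" "x \<in> closed_segment b b'" by auto
    then have "?n \<bullet> a = ?n \<bullet> b"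
      using seg[of x a a' ?n] seg[of x b b' ?n] by (simp add: dot_cross_self)
    then show False using D by (simp add: inner_commute inner_diff_left)
  qed
  moreover have "lattice_polytope k (closed_segment c d)"
    if "c \<in> lattice_box k" "d \<in> lattice_box k" for c d :: "real^3"
    unfolding lattice_polytope_def segment_convex_hull using that by (intro exI[of _ "{c, d}"]) simp
  ultimately have "setdist (closed_segment a a') (closed_segment b b') \<in> polytope_distances TYPE(3) k"
    unfolding polytope_distances_def using assms(1-4) by blast
  then have "epsilon TYPE(3) k \<le> setdist (closed_segment a a') (closed_segment b b')"
    unfolding epsilon_def by (intro Min_le finite_polytope_distances)
  also have "\<dots> \<le> dist p q"
    using assms by (intro setdist_le_dist)
  finally show ?thesis by (simp add: dist_norm)
qed

lemma vector_3_in_lattice_box: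
  "vector [x, y, z] \<in> (lattice_box k :: (real^3) set) \<longleftrightarrow>
    (x \<in> \<int> \<and> 0 \<le> x \<and> x \<le> real k) \<and> (y \<in> \<int> \<and> 0 \<le> y \<and> y \<le> real k) \<and> (z \<in> \<int> \<and> 0 \<le> z \<and> z \<le> real k)"
  by (simp add: lattice_box_def forall_3)

text \<open>The directions \<open>(k, k, k-1)\<close> and \<open>(k-3, k-1, -k)\<close> have
  deficits \<open>(0, 0, 1)\<close> and \<open>(3, 1, 0)\<close>, where the box estimate is an
  equality. The determinant is -1, and \<open>n\<close> is the cross product.\<close>

lemma epsilon_le_example:
  assumes "2 \<le> k"
  shows "epsilon TYPE(3) k \<le> 1 / sqrt (kiss_bound (real k))"
proof -
  define x where "x = real k"
  define j where "j = x - 2"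
  have x: "2 \<le> x" "0 \<le> j" "x = j + 2" using assms by (simp_all add: x_def j_def)
  define M where "M = kiss_bound x"
  \<comment> \<open>\<open>L / M\<close> and \<open>R / M\<close> are the parameters of the closest points on the two segments.\<close>
  define L where "L = (x\<^sup>2 - x + 1) * (3 * x\<^sup>2 - 8 * x + 10) + (x\<^sup>2 - 2 * x + 3) * (x\<^sup>2 - 3 * x)"
  define R where "R = (x\<^sup>2 - x + 1) * (x\<^sup>2 - 3 * x) + (x\<^sup>2 - 2 * x + 3) * (3 * x\<^sup>2 - 2 * x + 1)"
  define a a' b b' :: "real^3" where "a = vector [0, 0, 1]" and "a' = vector [x, x, x]"
    and "b = vector [1, 0, x]" and "b' = vector [x - 2, x - 1, 0]"
  define p where "p = (1 - L / M) *\<^sub>R a + (L / M) *\<^sub>R a'"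
  define q where "q = (1 - R / M) *\<^sub>R b + (R / M) *\<^sub>R b'"
  define n :: "real^3" where "n = vector [- (2 * x\<^sup>2 - 2 * x + 1), 2 * x\<^sup>2 - 4 * x + 3, 2 * x]"
  have jp: "0 \<le> j ^ 2" "0 \<le> j ^ 3" "0 \<le> j ^ 4" using x by simp_all
  \<comment> \<open>In \<open>j = x - 2\<close> the polynomials \<open>M\<close>, \<open>L\<close>,
    \<open>R\<close>, \<open>M - L\<close> and \<open>M - R\<close> have positive coefficients, so
    both parameters lie in \<open>[0, 1]\<close>.\<close>
  have "M = 8 * j ^ 4 + 40 * j ^ 3 + 88 * j\<^sup>2 + 100 * j + 50"
    "L = 4 * j ^ 4 + 16 * j ^ 3 + 30 * j\<^sup>2 + 29 * j + 12"
    "R = 4 * j ^ 4 + 20 * j ^ 3 + 42 * j\<^sup>2 + 45 * j + 21"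
    unfolding M_def L_def R_def kiss_bound_def x(3) by algebra+
  then have M: "0 < M" and L: "0 \<le> L" "L \<le> M" and R: "0 \<le> R" "R \<le> M"
    using jp x(2) by linarith+
  have pq: "p - q = (1 / M) *\<^sub>R n"
  proof -
    have "L * x - M - R * (x - 3) = - (2 * x\<^sup>2 - 2 * x + 1)"
      "L * x - R * (x - 1) = 2 * x\<^sup>2 - 4 * x + 3"
      "L * (x - 1) - M * (x - 1) + R * x = 2 * x"
      unfolding L_def R_def M_def kiss_bound_def by algebra+
    then have n: "n = vector [L * x - M - R * (x - 3), L * x - R * (x - 1), L * (x - 1) - M * (x - 1) + R * x]"
      by (simp add: n_def)
    show ?thesis
      using M by (simp add: p_def q_def a_def a'_def b_def b'_def n vec_eq_iff forall_3 field_simps)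
  qed
  have "(norm n)\<^sup>2 = M"
    unfolding norm_sq_3 by (simp add: n_def M_def kiss_bound_def) algebra
  then have "(norm (p - q))\<^sup>2 = 1 / M"
    unfolding pq using M by (simp add: power_mult_distrib power2_eq_square)
  then have "norm (p - q) = sqrt (1 / M)"
    by (metis norm_ge_zero real_sqrt_unique)
  moreover have "epsilon TYPE(3) k \<le> norm (p - q)"
  proof (rule epsilon_le_segments)
    show "a \<in> lattice_box k" "a' \<in> lattice_box k" "b \<in> lattice_box k" "b' \<in> lattice_box k"
      using assms by (auto simp: a_def a'_def b_def b'_def x_def vector_3_in_lattice_box)
    show "p \<in> closed_segment a a'"
      unfolding p_def in_segment using L M by (intro exI[of _ "L / M"]) simp
    show "q \<in> closed_segment b b'"
      unfolding q_def in_segment using R M by (intro exI[of _ "R / M"]) simp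
    have "(b - a) \<bullet> cross3 (a' - a) (b' - b) = - 1"
      by (simp add: inner_cross3 det3_def a_def a'_def b_def b'_def algebra_simps)
    then show "(b - a) \<bullet> cross3 (a' - a) (b' - b) \<noteq> 0" by simp
  qed
  ultimately show ?thesis
    by (simp add: M_def x_def real_sqrt_divide)
qed

text \<open>For \<open>k = 1\<close> the endpoint \<open>b'\<close> of the general example would
  leave the cube. A main diagonal and a face diagonal that does not meet it take its place.\<close>

lemma epsilon_le_unit_cube: "epsilon TYPE(3) 1 \<le> 1 / sqrt (kiss_bound 1)"
proof -
  let ?p = "vector [1/3, 1/3, 1/3] :: real^3" and ?q = "vector [1/2, 1/2, 0] :: real^3"
  have "epsilon TYPE(3) 1 \<le> norm (?p - ?q)"
  proof (rule epsilon_le_segments)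
    show "vector [0, 0, 0] \<in> (lattice_box 1 :: (real^3) set)" "vector [1, 1, 1] \<in> (lattice_box 1 :: (real^3) set)"
      "vector [1, 0, 0] \<in> (lattice_box 1 :: (real^3) set)" "vector [0, 1, 0] \<in> (lattice_box 1 :: (real^3) set)"
      by (simp_all add: vector_3_in_lattice_box)
    show "?p \<in> closed_segment (vector [0, 0, 0]) (vector [1, 1, 1])"
      unfolding in_segment by (intro exI[of _ "1/3"]) (simp add: vec_eq_iff forall_3)
    show "?q \<in> closed_segment (vector [1, 0, 0]) (vector [0, 1, 0])"
      unfolding in_segment by (intro exI[of _ "1/2"]) (simp add: vec_eq_iff forall_3)
  qed (simp add: inner_cross3 det3_def)
  also have "norm (?p - ?q) = sqrt (1 / 6)"
  proof (rule real_sqrt_unique[symmetric])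
    show "(norm (?p - ?q))\<^sup>2 = 1 / 6"
      unfolding norm_sq_3 by (simp add: power2_eq_square)
  qed simp
  finally show ?thesis by (simp add: kiss_bound_def real_sqrt_divide)
qed

theorem theorem1p1:
  fixes k :: nat
  assumes "k > 0" and "k \<noteq> 3"
  shows "epsilon TYPE(3) k =
    1 / sqrt (2 * (2 * real k ^ 2 - 4 * real k + 5) * (2 * real k ^ 2 - 2 * real k + 1))"
proof -
  have "epsilon TYPE(3) k \<in> polytope_distances TYPE(3) k"
    unfolding epsilon_def
    by (intro Min_in finite_polytope_distances polytope_distances_nonempty assms)
  then obtain P Q :: "(real^3) set" where PQ: "lattice_polytope k P" "lattice_polytope k Q" "P \<inter> Q = {}"
    and eps: "epsilon TYPE(3) k = setdist P Q"
    unfolding polytope_distances_def by auto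
  obtain p q where pq: "p \<in> P" "q \<in> Q" "setdist P Q = norm (p - q)"
    "\<And>p' q'. p' \<in> P \<Longrightarrow> q' \<in> Q \<Longrightarrow> norm (p - q) \<le> norm (p' - q')"
    using setdist_lattice_polytopes_attained[OF PQ(1,2)] by metis
  obtain S T where ST: "finite S" "S \<subseteq> lattice_box k" "P = convex hull S"
    "finite T" "T \<subseteq> lattice_box k" "Q = convex hull T"
    using PQ unfolding lattice_polytope_def by metis
  have "p \<noteq> q" using pq PQ(3) by auto
  then have "1 \<le> kiss_bound (real k) * (norm (p - q))\<^sup>2"
    using pq ST by (intro kiss_bound_separation[OF assms ST(1,2,4,5)]) auto
  moreover have pos: "0 < kiss_bound (real k)"
    using kiss_bound_nat_ge(3)[OF assms(1)] by simp
  ultimately have "sqrt (1 / kiss_bound (real k)) \<le> norm (p - q)"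
    by (intro real_le_lsqrt) (auto simp: field_simps)
  moreover have "epsilon TYPE(3) k \<le> 1 / sqrt (kiss_bound (real k))"
    using epsilon_le_example[of k] epsilon_le_unit_cube assms(1) by (cases "k = 1") auto
  ultimately have "epsilon TYPE(3) k = 1 / sqrt (kiss_bound (real k))"
    unfolding eps pq(3) by (simp add: real_sqrt_divide)
  then show ?thesis unfolding kiss_bound_def .
qed

end
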